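(* Let $G=W(E_6)$ act on its $6$-dimensional real reflection representation $W$, and let $V=W\oplus W$, in the explicit coordinates of the context, with $a,b\in W$, $M_0=\frac1{\sqrt2}[a\ b]\in V$ and $C_j=a\,u_j^T=(\cos(j\pi/4)\,a,\ \sin(j\pi/4)\,a)\in V$ for $j=0,1,2,3$ as defined there. Then the set $$X=GM_0\sqcup GC_0\sqcup GC_1\sqcup GC_2\sqcup GC_3\subset S(V)=S^{11}$$ (a disjoint union) is an unweighted spherical $4$-design with $|X|=270+4\cdot27=378$.
   Context: Let $$A=\begin{pmatrix}2&0&-1&0&0&0\\0&2&0&-1&0&0\\-1&0&2&-1&0&0\\0&-1&-1&2&-1&0\\0&0&0&-1&2&-1\\0&0&0&0&-1&2\end{pmatrix}$$ be the Cartan matrix of $E_6$. Let $W=\mathbb R^6$ (simple-root coordinates) with inner product $(v,w)=v^TAw$, and let $G=W(E_6)$ be the finite group (of order $51840$) generated by the simple reflections $s_i(v)=v-(Av)_ie_i$, $i=1,\dots,6$, where $e_i$ is the $i$th coordinate vector. Let $V=W\oplus W$ with the diagonal $G$-action and the orthogonal direct sum inner product; $S(V)=S^{11}$ is its unit sphere. A pair $(x_1,x_2)\in V$ is also written as a two-column matrix $[x_1\ x_2]$. Set $a_0=(2,3,4,6,5,4)^T$, $b_0=(2,1,2,2,1,0)^T$, $a=a_0/\sqrt{12}$, $b=b_0/2$ (these are orthonormal in $W$), and $u_j=(\cos(j\pi/4),\sin(j\pi/4))^T$, $j=0,1,2,3$. A finite set $X\subset S(V)$ is a (unweighted) spherical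 $4$-design if $\frac1{|X|}\sum_{x\in X}f(x)$ equals the average of $f$ over $S(V)$ with respect to normalized spherical measure for every real polynomial $f$ of degree at most $4$. *)

theory Defs
  imports "HOL-Analysis.Analysis" "HOL-Algebra.Bij" "HOL-Algebra.Generated_Groups"
begin

text \<open>
  Throughout, \<open>B\<close> is meant to be an inner product (a positive definite symmetric bilinear
  form) on a finite-dimensional real space.  It need not be the inner product of the type class.
\<close>

definition unit_sphere :: "('a::euclidean_space \<Rightarrow> 'a \<Rightarrow> real) \<Rightarrow> 'a set" where
  "unit_sphere B = {x. B x x = 1}"

definition unit_ball :: "('a::euclidean_space \<Rightarrow> 'a \<Rightarrow> real) \<Rightarrow> 'a set" where
  "unit_ball B = {x. B x x \<le> 1}"

text \<open>
  The normalized spherical measure: a Borel set \<open>E\<close> of unit vectors has as measure the proportion of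
  the volume of the unit ball of \<open>B\<close> that is taken by the cone over \<open>E\<close>.  Lebesgue measure in any
  linear coordinates may be used here, since a change of coordinates only rescales it.
  The radial projection sends \<open>0\<close> to \<open>0\<close>, which is irrelevant as \<open>{0}\<close> is a null set.
\<close>

definition sphere_measure :: "('a::euclidean_space \<Rightarrow> 'a \<Rightarrow> real) \<Rightarrow> 'a measure" where
  "sphere_measure B =
     distr (uniform_measure lborel (unit_ball B)) borel (\<lambda>x. x /\<^sub>R sqrt (B x x))"

text \<open>
  Real polynomial functions of total degree at most \<open>d\<close> in the coordinates \<open>x \<bullet> i\<close>, where \<open>i\<close>
  ranges over the standard basis; \<open>\<alpha>\<close> ranges over the exponents of the monomials.
\<close>

definition polynomial_of_degree_le :: "nat \<Rightarrow> ('a::euclidean_space \<Rightarrow> real) \<Rightarrow> bool" where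
  "polynomial_of_degree_le d f \<longleftrightarrow>
     (\<exists>c :: ('a \<Rightarrow> nat) \<Rightarrow> real. \<forall>x.
        f x = (\<Sum>\<alpha> \<in> {\<alpha> \<in> Basis \<rightarrow>\<^sub>E {..d}. (\<Sum>i\<in>Basis. \<alpha> i) \<le> d}.
                 c \<alpha> * (\<Prod>i\<in>Basis. (x \<bullet> i) ^ \<alpha> i)))"

definition spherical_design ::
    "('a::euclidean_space \<Rightarrow> 'a \<Rightarrow> real) \<Rightarrow> nat \<Rightarrow> 'a set \<Rightarrow> bool" where
  "spherical_design B t X \<longleftrightarrow>
     finite X \<and> X \<subseteq> unit_sphere B \<and>
     (\<forall>f. polynomial_of_degree_le t f \<longrightarrow>
        1 / real (card X) * (\<Sum>x\<in>X. f x) = (LINT x|sphere_measure B. f x))"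


text \<open>
  The six elements of the index type \<open>6\<close> are \<open>1, \<dots>, 5\<close> and \<open>6 = 0\<close>; \<open>vector\<close> lists the entries in
  the order \<open>1, \<dots>, 6\<close>.
\<close>

type_synonym W = "real ^ 6"
type_synonym V = "W \<times> W"

definition cartan_E6 :: "real ^ 6 ^ 6" where
  "cartan_E6 = vector
    [vector [ 2,  0, -1,  0,  0,  0],
     vector [ 0,  2,  0, -1,  0,  0],
     vector [-1,  0,  2, -1,  0,  0],
     vector [ 0, -1, -1,  2, -1,  0],
     vector [ 0,  0,  0, -1,  2, -1],
     vector [ 0,  0,  0,  0, -1,  2]]"

definition inner_W :: "W \<Rightarrow> W \<Rightarrow> real" where
  "inner_W v w = v \<bullet> (cartan_E6 *v w)"

definition inner_V :: "V \<Rightarrow> V \<Rightarrow> real" where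
  "inner_V x y = inner_W (fst x) (fst y) + inner_W (snd x) (snd y)"

definition simple_reflection :: "6 \<Rightarrow> W \<Rightarrow> W" where
  "simple_reflection i v = v - (cartan_E6 *v v) $ i *\<^sub>R axis i 1"

definition weyl_E6 :: "(W \<Rightarrow> W) set" where
  "weyl_E6 = generate (BijGroup UNIV) (range simple_reflection)"

definition orbit_V :: "V \<Rightarrow> V set" where
  "orbit_V x = (\<lambda>g. (g (fst x), g (snd x))) ` weyl_E6"

definition vec_a :: W where
  "vec_a = (1 / sqrt 12) *\<^sub>R vector [2, 3, 4, 6, 5, 4]"

definition vec_b :: W where
  "vec_b = (1 / 2) *\<^sub>R vector [2, 1, 2, 2, 1, 0]"

definition M0 :: V where
  "M0 = (1 / sqrt 2) *\<^sub>R (vec_a, vec_b)"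

definition C :: "nat \<Rightarrow> V" where
  "C j = (cos (real j * pi / 4) *\<^sub>R vec_a, sin (real j * pi / 4) *\<^sub>R vec_a)"

end

theory Submission
  imports Defs "HOL-Probability.Probability_Measure"
begin

text \<open>
  A finite \<open>X\<close> on the unit sphere is a \<open>t\<close>-design as soon as, for every \<open>k \<le> t\<close>, the power sum
  \<open>\<Sum>x\<in>X. (x, y)^k\<close> is a constant multiple of \<open>|y|^k\<close>: the spherical measure is invariant under
  isometries, so its moments have the same shape, and polarisation passes from powers of linear
  forms to all monomials.

  The orbit of \<open>a\<^sub>0\<close> consists of \<open>3\<close> times the \<open>27\<close> weights of the minuscule representation.  For
  each \<open>x\<close> in it there are ten \<open>y\<close> with \<open>(x, y) = -6\<close>, and the orbit of \<open>M\<^sub>0\<close> corresponds to these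
  \<open>270\<close> pairs through \<open>(x, y) \<mapsto> (x, 2 y + x)\<close> up to scaling of the two columns.  Then \<open>x\<close>, \<open>y\<close> and
  \<open>z = - x - y\<close> play symmetric roles, which reduces all power sums to those over the \<open>27\<close> vectors;
  the terms \<open>(x, v)^2 (x, w)^2\<close> coming from \<open>M\<^sub>0\<close> and from the \<open>C\<^sub>j\<close> cancel.
\<close>

section \<open>Invariance of the spherical measure\<close>

text \<open>Uniqueness of a translation-invariant measure up to a factor: integrate
  \<open>indicator D y * indicator A (y + x)\<close> in both orders by Fubini, translating
  \<open>y\<close> in one and \<open>x\<close> in the other. This replaces a determinant computation
  later on.\<close>

lemma translation_invariant_emeasure:
  fixes M :: "'a::euclidean_space measure"
  assumes sets_M: "sets M = sets borel"
    and "sigma_finite_measure M"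
    and inv: "\<And>c. distr M borel ((+) c) = M"
    and A: "A \<in> sets borel" and D: "D \<in> sets borel"
  shows "emeasure M A * emeasure lborel D = emeasure lborel A * emeasure M (uminus -` D)"
proof -
  interpret M: sigma_finite_measure M by fact
  interpret P: pair_sigma_finite M "lborel :: 'a measure" ..
  note [measurable_cong] = sets_M
  note [measurable] = A D
  have shift: "(\<integral>\<^sup>+x. f x \<partial>M) = (\<integral>\<^sup>+x. f (c + x) \<partial>M)"
    if [measurable]: "f \<in> borel_measurable borel" for f c
    by (subst (1) inv[of c, symmetric], subst nn_integral_distr) auto
  have shift': "(\<integral>\<^sup>+x. f x \<partial>lborel) = (\<integral>\<^sup>+x. f (c + x) \<partial>lborel)"
    if [measurable]: "f \<in> borel_measurable borel" for f and c :: 'a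
    by (subst (1) lborel_distr_plus[of c, symmetric], subst nn_integral_distr) auto
  have D': "uminus -` D \<in> sets M"
    using measurable_sets[of "uminus" borel borel D] sets_M D by simp
  have "emeasure M A * emeasure lborel D =
      (\<integral>\<^sup>+y. indicator D y * (\<integral>\<^sup>+x. indicator A x \<partial>M) \<partial>lborel)"
    by (simp add: sets_M A D nn_integral_multc mult.commute)
  also have "\<dots> = (\<integral>\<^sup>+y. \<integral>\<^sup>+x. indicator D y * indicator A (y + x) \<partial>M \<partial>lborel)"
  proof (rule nn_integral_cong)
    fix y
    have "indicator D y * (\<integral>\<^sup>+x. indicator A x \<partial>M) =
        indicator D y * (\<integral>\<^sup>+x. indicator A (y + x) \<partial>M)"
      by (subst shift[of _ y]) auto
    also have "\<dots> = (\<integral>\<^sup>+x. indicator D y * indicator A (y + x) \<partial>M)"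
      by (rule nn_integral_cmult[symmetric]) measurable
    finally show "indicator D y * (\<integral>\<^sup>+x. indicator A x \<partial>M) =
        (\<integral>\<^sup>+x. indicator D y * indicator A (y + x) \<partial>M)" .
  qed
  also have "\<dots> = (\<integral>\<^sup>+x. \<integral>\<^sup>+y. indicator D y * indicator A (y + x) \<partial>lborel \<partial>M)"
    using P.Fubini[of "\<lambda>(x, y). indicator D y * indicator A (y + x)"] by simp
  also have "\<dots> = (\<integral>\<^sup>+x. \<integral>\<^sup>+y. indicator D (- x + y) * indicator A y \<partial>lborel \<partial>M)"
  proof (rule nn_integral_cong)
    fix x
    show "(\<integral>\<^sup>+y. indicator D y * indicator A (y + x) \<partial>lborel) =
        (\<integral>\<^sup>+y. indicator D (- x + y) * indicator A y \<partial>lborel)"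
      by (subst shift'[of _ "- x"]) (auto simp: algebra_simps)
  qed
  also have "\<dots> = (\<integral>\<^sup>+y. \<integral>\<^sup>+x. indicator D (- x + y) * indicator A y \<partial>M \<partial>lborel)"
    using P.Fubini[of "\<lambda>(x, y). indicator D (- x + y) * indicator A y"] by simp
  also have "\<dots> = (\<integral>\<^sup>+y. indicator A y * emeasure M (uminus -` D) \<partial>lborel)"
  proof (rule nn_integral_cong)
    fix y
    have "(\<integral>\<^sup>+x. indicator D (- x + y) * indicator A y \<partial>M) =
        (\<integral>\<^sup>+x. indicator D (- x + y) \<partial>M) * indicator A y"
      by (rule nn_integral_multc) measurable
    also have "(\<integral>\<^sup>+x. indicator D (- x + y) \<partial>M) = (\<integral>\<^sup>+x. indicator (uminus -` D) x \<partial>M)"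
      by (subst shift[of _ y]) (auto intro!: nn_integral_cong simp: indicator_def)
    also have "\<dots> = emeasure M (uminus -` D)"
      using D' by simp
    finally show "(\<integral>\<^sup>+x. indicator D (- x + y) * indicator A y \<partial>M) =
        indicator A y * emeasure M (uminus -` D)"
      by (simp add: mult.commute)
  qed
  also have "\<dots> = emeasure lborel A * emeasure M (uminus -` D)"
    by (simp add: nn_integral_multc)
  finally show ?thesis .
qed

section \<open>Isometries and the sphere of an arbitrary inner product\<close>

locale inner_form =
  fixes B :: "'a::euclidean_space \<Rightarrow> 'a \<Rightarrow> real"
  assumes bilinear: "bilinear B"
    and sym: "B x y = B y x"
    and pos: "x \<noteq> 0 \<Longrightarrow> B x x > 0"
begin

lemmas [simp] = bilinear_ladd[OF bilinear] bilinear_radd[OF bilinear]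
  bilinear_lmul[OF bilinear] bilinear_rmul[OF bilinear] bilinear_lsub[OF bilinear]
  bilinear_rsub[OF bilinear] bilinear_lneg[OF bilinear] bilinear_rneg[OF bilinear]
  bilinear_lzero[OF bilinear] bilinear_rzero[OF bilinear]

lemma nonneg [simp]: "B x x \<ge> 0"
  using pos[of x] by (cases "x = 0") auto

lemma continuous_on_form [continuous_intros]:
  "continuous_on S f \<Longrightarrow> continuous_on S g \<Longrightarrow> continuous_on S (\<lambda>x. B (f x) (g x))"
  using bilinear_conv_bounded_bilinear[of B] bilinear bounded_bilinear.continuous_on by blast

lemma measurable_form [measurable]:
  "f \<in> borel_measurable N \<Longrightarrow> g \<in> borel_measurable N \<Longrightarrow> (\<lambda>x. B (f x) (g x)) \<in> borel_measurable N"
  using borel_measurable_continuous_Pair[of f N g B]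
  by (simp add: continuous_intros split_beta)

lemma unit_ball_sets [measurable]: "unit_ball B \<in> sets borel"
  unfolding unit_ball_def by measurable

text \<open>By compactness \<open>B\<close> has a positive minimum \<open>m\<close> on the Euclidean
  unit sphere, and homogeneity gives \<open>m * (norm x)\<^sup>2 \<le> B x x\<close>.\<close>

lemma bounded_unit_ball: "bounded (unit_ball B)"
proof (cases "sphere (0::'a) 1 = {}")
  case True
  then have "x = 0" for x :: 'a
    using norm_sgn[of x] by (auto simp: dist_norm sphere_def split: if_splits)
  then have "unit_ball B \<subseteq> {0}" by blast
  then show ?thesis by (rule bounded_subset[rotated]) auto
next
  case False
  have "continuous_on (sphere 0 1) (\<lambda>x. B x x)" by (intro continuous_intros)
  then obtain u where u: "u \<in> sphere 0 1" "\<And>x. x \<in> sphere 0 1 \<Longrightarrow> B u u \<le> B x x"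
    using continuous_attains_inf[OF compact_sphere False] by blast
  define m where "m = B u u"
  have m: "m > 0" using u(1) unfolding m_def by (intro pos) auto
  have "norm x \<le> sqrt (1 / m)" if "x \<in> unit_ball B" for x
  proof (cases "x = 0")
    case False
    then have "m \<le> B (x /\<^sub>R norm x) (x /\<^sub>R norm x)"
      unfolding m_def by (intro u(2)) auto
    also have "\<dots> = B x x / (norm x)\<^sup>2"
      by (simp add: power2_eq_square divide_inverse)
    finally have "m * (norm x)\<^sup>2 \<le> 1"
      using that False by (simp add: unit_ball_def field_simps)
    then show ?thesis using m by (simp add: real_le_rsqrt field_simps)
  qed (use m in auto)
  then show ?thesis by (auto simp: bounded_iff)
qed

lemma emeasure_unit_ball_finite: "emeasure lborel (unit_ball B) < \<infinity>"
  by (rule emeasure_bounded_finite[OF bounded_unit_ball])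

lemma emeasure_unit_ball_pos: "emeasure lborel (unit_ball B) > 0"
proof -
  have "open {x. B x x < 1}" by (intro open_Collect_less continuous_intros)
  moreover have "0 \<in> {x. B x x < 1}" by simp
  ultimately obtain e where e: "e > 0" "ball 0 e \<subseteq> {x. B x x < 1}"
    using open_contains_ball by blast
  then have "ball 0 e \<subseteq> unit_ball B" by (auto simp: unit_ball_def)
  then have "emeasure lborel (ball (0::'a) e) \<le> emeasure lborel (unit_ball B)"
    by (intro emeasure_mono) auto
  moreover have "emeasure lborel (ball (0::'a) e) > 0"
    using e by (simp add: emeasure_ball content_ball_pos unit_ball_vol_pos)
  ultimately show ?thesis by order
qed

lemma isometry_bij:
  assumes T: "linear T" and iso: "\<And>x. B (T x) (T x) = B x x"
  shows "bij T"
proof -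
  have "inj T"
    unfolding linear_injective_0[OF T] using iso pos by (metis less_irrefl bilinear_lzero[OF bilinear])
  then show ?thesis
    using linear_injective_imp_surjective[OF T] by (simp add: bij_def)
qed

text \<open>The image measure is again translation invariant, hence proportional to
  \<open>lborel\<close>. The unit ball of \<open>B\<close> is symmetric, \<open>T\<close>-stable and
  of positive finite volume, so the factor is 1.\<close>

lemma lborel_distr_isometry:
  assumes T: "linear T" and iso: "\<And>x. B (T x) (T x) = B x x"
  shows "distr lborel borel T = lborel"
proof -
  have bij: "bij T" using T iso by (rule isometry_bij)
  define S where "S = inv_into UNIV T"
  have S: "S (T x) = x" "T (S x) = x" for x
    using bij by (simp_all add: S_def bij_def surj_f_inv_f)
  have [measurable]: "T \<in> borel_measurable borel"
    using linear_continuous_on T borel_measurable_continuous_onI linear_conv_bounded_linear by blast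
  have "linear S" 
    using T bij S_def by (simp add: bij_is_inj inj_linear_imp_inv_linear)
  then have [measurable]: "S \<in> borel_measurable borel"
    using linear_continuous_on borel_measurable_continuous_onI linear_conv_bounded_linear by blast
  define M where "M = distr lborel borel T"
  have sets_M: "sets M = sets borel" and space_M: "space M = UNIV" by (simp_all add: M_def)
  have "sigma_finite_measure M"
  proof
    \<comment> \<open>These are the images under \<open>T\<close> of the Euclidean balls around 0;
      they exhaust the space and have finite image measure.\<close>
    let ?F = "\<lambda>n::nat. {x. norm (S x) < real n}"
    have "emeasure M (?F n) \<noteq> \<infinity>" for n
    proof -
      have "T -` ?F n = ball 0 (real n)" by (auto simp: S)
      then show ?thesis
        using emeasure_lborel_ball_finite[of "0::'a" "real n"]
        by (simp add: M_def emeasure_distr)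
    qed
    then show "\<exists>A. countable A \<and> A \<subseteq> sets M \<and> \<Union> A = space M \<and> (\<forall>a\<in>A. emeasure M a \<noteq> \<infinity>)"
      using reals_Archimedean2 by (intro exI[of _ "range ?F"]) (auto simp: sets_M space_M)
  qed
  moreover have "distr M borel ((+) c) = M" for c
  proof -
    have "distr M borel ((+) c) = distr lborel borel ((+) c \<circ> T)"
      by (simp add: M_def distr_distr)
    \<comment> \<open>A translation after \<open>T\<close> is a translation before it, and the
      latter preserves \<open>lborel\<close>.\<close>
    also have "(+) c \<circ> T = T \<circ> (+) (S c)"
      by (auto simp: linear_add[OF T] S)
    also have "distr lborel borel (T \<circ> (+) (S c)) = distr (distr lborel borel ((+) (S c))) borel T"
      by (simp add: distr_distr)
    also have "\<dots> = M" by (simp add: lborel_distr_plus M_def)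
    finally show ?thesis .
  qed
  ultimately have eq: "emeasure M A * emeasure lborel (unit_ball B) =
      emeasure lborel A * emeasure M (uminus -` unit_ball B)" if "A \<in> sets borel" for A
    using that sets_M by (intro translation_invariant_emeasure) auto
  have "T -` uminus -` unit_ball B = unit_ball B"
    by (auto simp: unit_ball_def iso)
  then have "emeasure M (uminus -` unit_ball B) = emeasure lborel (unit_ball B)"
    using measurable_sets[of "uminus" borel borel "unit_ball B"]
    by (simp add: M_def emeasure_distr)
  then have "emeasure M A = emeasure lborel A" if "A \<in> sets borel" for A
    using eq[OF that] emeasure_unit_ball_finite emeasure_unit_ball_pos
    by (auto simp: mult.commute[of _ "emeasure lborel (unit_ball B)"] ennreal_mult_cancel_left)
  then show ?thesis
    unfolding M_def[symmetric] by (intro measure_eqI) (auto simp: sets_M)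
qed

lemma measurable_radial [measurable]: "(\<lambda>x. x /\<^sub>R sqrt (B x x)) \<in> borel_measurable borel"
  by measurable

lemma sets_sphere_measure [measurable_cong, simp]: "sets (sphere_measure B) = sets borel"
  and space_sphere_measure [simp]: "space (sphere_measure B) = UNIV"
  by (simp_all add: sphere_measure_def)

lemma prob_space_sphere_measure: "prob_space (sphere_measure B)"
proof -
  interpret prob_space "uniform_measure lborel (unit_ball B)"
    using emeasure_unit_ball_finite emeasure_unit_ball_pos
    by (intro prob_space_uniform_measure) auto
  show ?thesis
    unfolding sphere_measure_def by (rule prob_space_distr) (simp add: measurable_radial)
qed

text \<open>Only the origin is not projected to the sphere, and it is a null set.\<close>

lemma AE_unit_sphere: "AE x in sphere_measure B. x \<in> unit_sphere B"
proof -
  have "AE x in lborel. x \<noteq> (0::'a)" by (rule AE_lborel_singleton)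
  then have "AE x in lborel. x /\<^sub>R sqrt (B x x) \<in> unit_sphere B"
  proof eventually_elim
    case (elim x)
    then show ?case using pos[of x]
      by (simp add: unit_sphere_def field_simps flip: power2_eq_square)
  qed
  then have "AE x in uniform_measure lborel (unit_ball B). x /\<^sub>R sqrt (B x x) \<in> unit_sphere B"
    by (intro AE_uniform_measureI) auto
  moreover have "unit_sphere B \<in> sets borel" unfolding unit_sphere_def by measurable
  ultimately show ?thesis
    unfolding sphere_measure_def by (subst AE_distr_iff) (auto simp: measurable_radial)
qed

text \<open>An isometry preserves the uniform measure on the ball and commutes with the radial
  projection.\<close>

lemma sphere_measure_isometry:
  assumes T: "linear T" and iso: "\<And>x. B (T x) (T x) = B x x"
  shows "distr (sphere_measure B) borel T = sphere_measure B"
proof -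
  have [measurable]: "T \<in> borel_measurable borel"
    using linear_continuous_on T borel_measurable_continuous_onI linear_conv_bounded_linear by blast
  let ?U = "uniform_measure lborel (unit_ball B)" and ?p = "\<lambda>x. x /\<^sub>R sqrt (B x x)"
  have "T -` unit_ball B = unit_ball B" by (auto simp: unit_ball_def iso)
  then have "distr ?U borel T = uniform_measure (distr lborel borel T) (unit_ball B)"
    using measurable_sets[OF \<open>T \<in> borel_measurable borel\<close>]
    by (intro measure_eqI) (simp_all add: emeasure_distr vimage_Int)
  then have U: "distr ?U borel T = ?U"
    by (simp add: lborel_distr_isometry[OF assms])
  have "distr (sphere_measure B) borel T = distr ?U borel (T \<circ> ?p)"
    by (simp add: sphere_measure_def distr_distr)
  also have "T \<circ> ?p = ?p \<circ> T"
    by (auto simp: iso linear_cmul[OF T])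
  also have "distr ?U borel (?p \<circ> T) = distr (distr ?U borel T) borel ?p"
    by (simp add: distr_distr)
  finally show ?thesis by (simp add: U sphere_measure_def)
qed

lemma compact_unit_sphere: "compact (unit_sphere B)"
  unfolding compact_eq_bounded_closed
proof
  show "bounded (unit_sphere B)"
    by (rule bounded_subset[OF bounded_unit_ball]) (auto simp: unit_sphere_def unit_ball_def)
  show "closed (unit_sphere B)"
    unfolding unit_sphere_def by (intro closed_Collect_eq continuous_intros)
qed

lemma integrable_sphere_measure:
  fixes f :: "'a \<Rightarrow> real"
  assumes f: "continuous_on UNIV f"
  shows "integrable (sphere_measure B) f"
proof -
  interpret prob_space "sphere_measure B" by (rule prob_space_sphere_measure)
  have "bounded (f ` unit_sphere B)"
    using compact_unit_sphere f
    by (intro compact_imp_bounded compact_continuous_image) (auto intro: continuous_on_subset)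
  then obtain K where "\<And>x. x \<in> unit_sphere B \<Longrightarrow> norm (f x) \<le> K"
    by (auto simp: bounded_iff)
  then show ?thesis
    using AE_unit_sphere borel_measurable_continuous_onI[OF f]
    by (intro integrable_const_bound[of _ K]) (auto elim!: eventually_mono)
qed

text \<open>The reflection in the hyperplane orthogonal to \<open>y - z\<close> takes
  \<open>y\<close> to \<open>z\<close>, because the two vectors have equal length.\<close>

lemma isometry_transitive:
  assumes "B y y = B z z"
  obtains T where "linear T" "\<And>u v. B (T u) (T v) = B u v" "T y = z"
proof (cases "y = z")
  case True
  then show ?thesis using that[of id] by (auto simp: linear_id)
next
  case False
  define d where "d = y - z"
  have d: "B d d > 0" using False by (intro pos) (simp add: d_def)
  define T where "T x = x - (2 * B x d / B d d) *\<^sub>R d" for x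
  have "linear T"
    by (rule linearI) (auto simp: T_def algebra_simps add_divide_distrib)
  moreover have "B (T u) (T v) = B u v" for u v
    using d sym[of d v] by (simp add: T_def field_simps)
  moreover have "2 * B y d = B d d"
    using assms sym[of z y] by (simp add: d_def)
  then have "T y = z" using d by (simp add: T_def d_def)
  ultimately show ?thesis using that by blast
qed

lemma moment_eq:
  assumes "B y y = B z z"
  shows "(LINT x|sphere_measure B. B x y ^ k) = (LINT x|sphere_measure B. B x z ^ k)"
proof -
  obtain T where T: "linear T" "\<And>u v. B (T u) (T v) = B u v" "T y = z"
    using isometry_transitive[OF assms] by blast
  have [measurable]: "T \<in> borel_measurable borel"
    using linear_continuous_on T(1) borel_measurable_continuous_onI linear_conv_bounded_linear by blast
  have "(LINT x|sphere_measure B. B x z ^ k) =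
      (LINT x|distr (sphere_measure B) borel T. B x (T y) ^ k)"
    by (simp add: sphere_measure_isometry T)
  also have "\<dots> = (LINT x|sphere_measure B. B (T x) (T y) ^ k)"
    by (subst integral_distr) auto
  finally show ?thesis by (simp add: T(2))
qed

section \<open>From power sums to all polynomials\<close>

lemma coordinate_representable: "\<exists>z. \<forall>x. B x z = x \<bullet> i"
proof -
  \<comment> \<open>\<open>A\<close> is the Gram operator of \<open>B\<close> with respect to the
    standard inner product. Definiteness makes it injective, hence onto, so every linear functional
    has the form \<open>B x z\<close> for a fixed \<open>z\<close>.\<close>
  define A where "A y = (\<Sum>j\<in>Basis. B j y *\<^sub>R j)" for y
  have A: "x \<bullet> A y = B x y" for x y
  proof -
    have "B x y = B (\<Sum>j\<in>Basis. (x \<bullet> j) *\<^sub>R j) y" by (simp add: euclidean_representation)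
    also have "\<dots> = (\<Sum>j\<in>Basis. (x \<bullet> j) * B j y)"
      using bilinear by (simp add: bilinear_def linear_sum[of "\<lambda>x. B x y"])
    finally show ?thesis by (simp add: A_def inner_sum_right mult.commute)
  qed
  have "linear A"
    by (rule linearI) (simp_all add: A_def algebra_simps sum.distrib scaleR_sum_right)
  moreover have "inj A"
  proof (subst linear_injective_0[OF \<open>linear A\<close>], intro allI impI)
    fix x assume "A x = 0"
    then have "B x x = 0" using A[of x x] by simp
    then show "x = 0" using pos[of x] by auto
  qed
  ultimately have "surj A" by (intro linear_injective_imp_surjective) auto
  then obtain z where "A z = i" by (metis surjD)
  then show ?thesis using A by metis
qed

text \<open>Turns a monomial into a product of linear forms \<open>B x z\<close>, the shape on which
  polarisation acts.\<close>

lemma monomial_as_product: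
  assumes "finite S"
  shows "\<exists>zs. length zs = (\<Sum>i\<in>S. \<alpha> i) \<and> (\<forall>x. prod_list (map (B x) zs) = (\<Prod>i\<in>S. (x \<bullet> i) ^ \<alpha> i))"
  using assms
proof induction
  case (insert i S)
  then obtain zs where zs: "length zs = (\<Sum>i\<in>S. \<alpha> i)"
      "\<And>x. prod_list (map (B x) zs) = (\<Prod>i\<in>S. (x \<bullet> i) ^ \<alpha> i)" by blast
  obtain z where z: "\<And>x. B x z = x \<bullet> i" using coordinate_representable by blast
  show ?case
    using insert.hyps by (intro exI[of _ "replicate (\<alpha> i) z @ zs"]) (simp add: zs z)
qed auto

text \<open>
  The constant in the hypothesis need not be known: integrating it over \<open>y\<close> in the sphere
  identifies it with a moment of the spherical measure.
\<close>

lemma spherical_design_if_power_sums: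
  assumes X: "finite X" "X \<noteq> {}" "X \<subseteq> unit_sphere B"
    and sums: "\<And>k. k \<le> t \<Longrightarrow> \<exists>c. \<forall>y. (\<Sum>x\<in>X. B x y ^ k) = c * sqrt (B y y) ^ k"
  shows "spherical_design B t X"
proof -
  interpret prob_space "sphere_measure B" by (rule prob_space_sphere_measure)
  \<comment> \<open>\<open>D f\<close> is the cubature error of \<open>X\<close> on
    \<open>f\<close>. It is linear, so it suffices to show that it vanishes on monomials.\<close>
  define D where "D f = 1 / real (card X) * (\<Sum>x\<in>X. f x) - (LINT x|sphere_measure B. f x)"
    for f :: "'a \<Rightarrow> real"
  have D_sum: "D (\<lambda>x. \<Sum>i\<in>I. c i * f i x) = (\<Sum>i\<in>I. c i * D (f i))"
    if f: "\<And>i. i \<in> I \<Longrightarrow> continuous_on UNIV (f i)" for I :: "'i set" and c f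
  proof -
    have "(LINT x|sphere_measure B. (\<Sum>i\<in>I. c i * f i x)) =
        (\<Sum>i\<in>I. c i * (LINT x|sphere_measure B. f i x))"
      by (subst Bochner_Integration.integral_sum)
        (auto intro!: integrable_mult_right integrable_sphere_measure f)
    moreover have "(\<Sum>x\<in>X. (\<Sum>i\<in>I. c i * f i x)) = (\<Sum>i\<in>I. c i * (\<Sum>x\<in>X. f i x))"
      by (subst sum.swap) (simp add: sum_distrib_left)
    moreover have "r * (\<Sum>i\<in>I. c i * p i) - (\<Sum>i\<in>I. c i * q i) =
        (\<Sum>i\<in>I. c i * (r * p i - q i))" for r p q
      by (simp add: sum_distrib_left sum_subtractf right_diff_distrib mult_ac)
    ultimately show ?thesis
      by (simp only: D_def)
  qed
  have D_power: "D (\<lambda>x. B x y ^ k) = 0" if k: "k \<le> t" for k y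
  proof -
    obtain x0 where x0: "x0 \<in> X" using X by blast
    have X1: "B x x = 1" if "x \<in> X" for x using that X by (auto simp: unit_sphere_def)
    define K where "K = (LINT x|sphere_measure B. B x x0 ^ k)"
    have K: "(LINT x|sphere_measure B. B x u ^ k) = K" if "B u u = 1" for u
      unfolding K_def using that X1[OF x0] by (intro moment_eq) simp
    obtain c where c: "\<And>u. (\<Sum>x\<in>X. B x u ^ k) = c * sqrt (B u u) ^ k"
      using sums[OF k] by blast
    \<comment> \<open>On the unit sphere the power sum is constantly \<open>c\<close>. Exchanging
      sum and integral and using the symmetry of \<open>B\<close> then expresses \<open>c\<close>
      through the moment \<open>K\<close>.\<close>
    have "(LINT u|sphere_measure B. (\<Sum>x\<in>X. B x u ^ k)) = (LINT u|sphere_measure B. c)"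
    proof (rule integral_cong_AE)
      show "AE u in sphere_measure B. (\<Sum>x\<in>X. B x u ^ k) = c"
        using AE_unit_sphere by eventually_elim (simp add: c unit_sphere_def)
    qed auto
    then have "(LINT u|sphere_measure B. (\<Sum>x\<in>X. B x u ^ k)) = c"
      using prob_space by simp
    then have "c = (\<Sum>x\<in>X. (LINT u|sphere_measure B. B x u ^ k))"
      by (subst (asm) Bochner_Integration.integral_sum)
        (auto intro!: integrable_sphere_measure continuous_intros)
    also have "\<dots> = card X * K"
    proof -
      have "(LINT u|sphere_measure B. B x u ^ k) = K" if "x \<in> X" for x
        using K[OF X1[OF that]] by (subst sym)
      then show ?thesis by simp
    qed
    finally have c': "c = card X * K" .
    have unit: "D (\<lambda>x. B x u ^ k) = 0" if "B u u = 1" for u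
      using that X by (simp add: D_def c K c')
    obtain r u where ru: "y = r *\<^sub>R u" "B u u = 1"
    proof (cases "y = 0")
      case True
      \<comment> \<open>The zero vector is 0 times any unit vector; \<open>x0\<close> serves as
        one.\<close>
      then show ?thesis using that[of 0 x0] X1[OF x0] by simp
    next
      case False
      then show ?thesis
        using that[of "sqrt (B y y)" "y /\<^sub>R sqrt (B y y)"] pos[of y]
        by (simp add: field_simps flip: power2_eq_square)
    qed
    have "D (\<lambda>x. B x y ^ k) = r ^ k * D (\<lambda>x. B x u ^ k)"
      using D_sum[of "{()}" "\<lambda>_ x. B x u ^ k" "\<lambda>_. r ^ k"]
      by (simp add: ru(1) power_mult_distrib continuous_intros)
    then show ?thesis by (simp add: unit ru(2))
  qed
  \<comment> \<open>Induction on the number of separate linear factors, with a power of one further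
    form kept general so that the next factor can be absorbed into it.\<close>
  have D_prod: "D (\<lambda>x. B x y ^ m * prod_list (map (B x) zs)) = 0" if "m + length zs \<le> t" for m zs y
    using that
  proof (induction zs arbitrary: m y)
    case Nil
    then show ?case by (simp add: D_power)
  next
    case (Cons z zs)
    let ?f = "\<lambda>j x. B x z ^ j * B x y ^ (Suc m - j) * prod_list (map (B x) zs)"
    have cont: "continuous_on UNIV (\<lambda>x. prod_list (map (B x) zs))"
      by (induction zs) (auto intro!: continuous_intros)
    \<comment> \<open>Replacing the base of the power by \<open>s *\<^sub>R z + y\<close> gives a
      polynomial in \<open>s\<close> that vanishes identically; its coefficient at \<open>s\<close>
      is \<open>Suc m\<close> times the wanted error.\<close>
    have "\<forall>s. (\<Sum>j\<le>Suc m. (real (Suc m choose j) * D (?f j)) * s ^ j) = 0"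
    proof
      fix s
      have "0 = D (\<lambda>x. B x (s *\<^sub>R z + y) ^ Suc m * prod_list (map (B x) zs))"
        using Cons by (intro Cons.IH[symmetric]) simp
      also have "(\<lambda>x. B x (s *\<^sub>R z + y) ^ Suc m * prod_list (map (B x) zs)) =
          (\<lambda>x. \<Sum>j\<le>Suc m. (real (Suc m choose j) * s ^ j) * ?f j x)"
        by (simp only: bilinear_radd[OF bilinear] bilinear_rmul[OF bilinear] binomial_ring sum_distrib_right)
           (simp add: power_mult_distrib mult_ac)
      also have "D \<dots> = (\<Sum>j\<le>Suc m. (real (Suc m choose j) * s ^ j) * D (?f j))"
        by (intro D_sum continuous_intros cont)
      finally show "(\<Sum>j\<le>Suc m. (real (Suc m choose j) * D (?f j)) * s ^ j) = 0"
        by (simp add: mult_ac)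
    qed
    then have "\<forall>j\<le>Suc m. real (Suc m choose j) * D (?f j) = 0"
      by (simp only: polyfun_eq_0)
    then have "real (Suc m choose 1) * D (?f 1) = 0"
      by (elim allE[of _ 1]) simp
    then have "D (?f 1) = 0"
      by simp
    then show ?case by (simp add: mult_ac)
  qed
  have "1 / real (card X) * (\<Sum>x\<in>X. f x) = (LINT x|sphere_measure B. f x)"
    if "polynomial_of_degree_le t f" for f
  proof -
    let ?I = "{\<alpha> \<in> (Basis :: 'a set) \<rightarrow>\<^sub>E {..t}. (\<Sum>i\<in>Basis. \<alpha> i) \<le> t}"
    let ?m = "\<lambda>\<alpha> (x :: 'a). \<Prod>i\<in>Basis. (x \<bullet> i) ^ \<alpha> i"
    from that obtain c where "\<forall>x. f x = (\<Sum>\<alpha>\<in>?I. c \<alpha> * ?m \<alpha> x)"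
      unfolding polynomial_of_degree_le_def by (elim exE)
    then have "D f = D (\<lambda>x. \<Sum>\<alpha>\<in>?I. c \<alpha> * ?m \<alpha> x)"
      by (intro arg_cong[of _ _ D] ext) (erule spec)
    also have "\<dots> = (\<Sum>\<alpha>\<in>?I. c \<alpha> * D (?m \<alpha>))"
      by (intro D_sum continuous_intros)
    also have "\<dots> = 0"
    proof (intro sum.neutral ballI)
      fix \<alpha> assume \<alpha>: "\<alpha> \<in> ?I"
      obtain zs where "length zs = (\<Sum>i\<in>(Basis :: 'a set). \<alpha> i)" "\<And>x. prod_list (map (B x) zs) = ?m \<alpha> x"
        using monomial_as_product[of Basis \<alpha>] by auto
      then have "D (?m \<alpha>) = 0"
        using D_prod[of 0 zs] \<alpha> by simp
      then show "c \<alpha> * D (?m \<alpha>) = 0" by simp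
    qed
    finally show ?thesis by (simp add: D_def)
  qed
  then show ?thesis using X by (auto simp: spherical_design_def)
qed

end

section \<open>The reflection representation\<close>

lemma exhaust_6: "(i :: 6) = 1 \<or> i = 2 \<or> i = 3 \<or> i = 4 \<or> i = 5 \<or> i = 6"
proof (induct i)
  case (of_int z)
  then have "z = 0 \<or> z = 1 \<or> z = 2 \<or> z = 3 \<or> z = 4 \<or> z = 5" by auto
  then show ?case by auto
qed

lemma forall_6: "(\<forall>i :: 6. P i) \<longleftrightarrow> P 1 \<and> P 2 \<and> P 3 \<and> P 4 \<and> P 5 \<and> P 6"
  by (metis exhaust_6)

lemma UNIV_6: "(UNIV :: 6 set) = {1, 2, 3, 4, 5, 6}"
  using exhaust_6 by auto

lemma sum_6: "(\<Sum>i\<in>UNIV. f (i :: 6)) = f 1 + f 2 + f 3 + f 4 + f 5 + (f 6 :: 'b::comm_monoid_add)"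
  unfolding UNIV_6 by (simp add: ac_simps)

lemma vector_6 [simp]:
  "(vector [a, b, c, d, e, f] :: 'b::zero ^ 6) $ 1 = a"
  "(vector [a, b, c, d, e, f] :: 'b ^ 6) $ 2 = b"
  "(vector [a, b, c, d, e, f] :: 'b ^ 6) $ 3 = c"
  "(vector [a, b, c, d, e, f] :: 'b ^ 6) $ 4 = d"
  "(vector [a, b, c, d, e, f] :: 'b ^ 6) $ 5 = e"
  "(vector [a, b, c, d, e, f] :: 'b ^ 6) $ 6 = f"
  unfolding vector_def by simp_all

lemma cartan_E6_mult:
  "(cartan_E6 *v v) $ 1 = 2 * v $ 1 - v $ 3"
  "(cartan_E6 *v v) $ 2 = 2 * v $ 2 - v $ 4"
  "(cartan_E6 *v v) $ 3 = 2 * v $ 3 - v $ 1 - v $ 4"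
  "(cartan_E6 *v v) $ 4 = 2 * v $ 4 - v $ 2 - v $ 3 - v $ 5"
  "(cartan_E6 *v v) $ 5 = 2 * v $ 5 - v $ 4 - v $ 6"
  "(cartan_E6 *v v) $ 6 = 2 * v $ 6 - v $ 5"
  by (simp_all add: matrix_vector_mult_def cartan_E6_def sum_6)

lemma inner_W_expand:
  "inner_W v w =
     v $ 1 * (2 * w $ 1 - w $ 3) + v $ 2 * (2 * w $ 2 - w $ 4) +
     v $ 3 * (2 * w $ 3 - w $ 1 - w $ 4) + v $ 4 * (2 * w $ 4 - w $ 2 - w $ 3 - w $ 5) +
     v $ 5 * (2 * w $ 5 - w $ 4 - w $ 6) + v $ 6 * (2 * w $ 6 - w $ 5)"
  by (simp add: inner_W_def inner_vec_def sum_6 cartan_E6_mult)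

definition vec6 :: "real \<Rightarrow> real \<Rightarrow> real \<Rightarrow> real \<Rightarrow> real \<Rightarrow> real \<Rightarrow> W" where
  "vec6 a b c d e f = vector [a, b, c, d, e, f]"

lemma vec6_nth [simp]:
  "vec6 a b c d e f $ 1 = a" "vec6 a b c d e f $ 2 = b" "vec6 a b c d e f $ 3 = c"
  "vec6 a b c d e f $ 4 = d" "vec6 a b c d e f $ 5 = e" "vec6 a b c d e f $ 6 = f"
  by (simp_all add: vec6_def)

lemma vec6_eq_iff [simp]:
  "vec6 a b c d e f = vec6 a' b' c' d' e' f' \<longleftrightarrow>
     a = a' \<and> b = b' \<and> c = c' \<and> d = d' \<and> e = e' \<and> f = f'"
  by (auto simp: vec_eq_iff forall_6)

lemma vec6_minus: "- vec6 a b c d e f = vec6 (- a) (- b) (- c) (- d) (- e) (- f)"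
  and vec6_diff: "vec6 a b c d e f - vec6 a' b' c' d' e' f' =
     vec6 (a - a') (b - b') (c - c') (d - d') (e - e') (f - f')"
  by (simp_all add: vec_eq_iff forall_6)

lemma simple_reflection_vec6:
  "simple_reflection 1 (vec6 a b c d e f) = vec6 (c - a) b c d e f"
  "simple_reflection 2 (vec6 a b c d e f) = vec6 a (d - b) c d e f"
  "simple_reflection 3 (vec6 a b c d e f) = vec6 a b (a + d - c) d e f"
  "simple_reflection 4 (vec6 a b c d e f) = vec6 a b c (b + c + e - d) e f"
  "simple_reflection 5 (vec6 a b c d e f) = vec6 a b c d (d + f - e) f"
  "simple_reflection 6 (vec6 a b c d e f) = vec6 a b c d e (e - f)"
  by (simp_all add: simple_reflection_def cartan_E6_mult vec_eq_iff forall_6 axis_def)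

text \<open>The scaling by 3 makes all coordinates integers. The list runs from the highest weight
  \<open>a0\<close> to the lowest, and its explicit form turns the facts below into finite
  computations.\<close>

definition weights :: "W set" where
  "weights =
    {vec6 2 3 4 6 5 4, vec6 2 3 4 6 5 1, vec6 2 3 4 6 2 1,
     vec6 2 3 4 3 2 1, vec6 2 0 4 3 2 1, vec6 2 3 1 3 2 1,
     vec6 2 0 1 3 2 1, vec6 (-1) 3 1 3 2 1, vec6 (-1) 0 1 3 2 1,
     vec6 2 0 1 0 2 1, vec6 (-1) 0 1 0 2 1, vec6 2 0 1 0 (-1) 1,
     vec6 (-1) 0 (-2) 0 2 1, vec6 (-1) 0 1 0 (-1) 1, vec6 2 0 1 0 (-1) (-2),
     vec6 (-1) 0 (-2) 0 (-1) 1, vec6 (-1) 0 1 0 (-1) (-2), vec6 (-1) 0 (-2) (-3) (-1) 1,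
     vec6 (-1) 0 (-2) 0 (-1) (-2), vec6 (-1) (-3) (-2) (-3) (-1) 1, vec6 (-1) 0 (-2) (-3) (-1) (-2),
     vec6 (-1) (-3) (-2) (-3) (-1) (-2), vec6 (-1) 0 (-2) (-3) (-4) (-2), vec6 (-1) (-3) (-2) (-3) (-4) (-2),
     vec6 (-1) (-3) (-2) (-6) (-4) (-2), vec6 (-1) (-3) (-5) (-6) (-4) (-2), vec6 (-4) (-3) (-5) (-6) (-4) (-2)}"

abbreviation a0 :: W where "a0 \<equiv> vec6 2 3 4 6 5 4"
text \<open>Determined by \<open>2 *\<^sub>R d0 + a0 = 6 *\<^sub>R vec_b\<close>, so that the pair
  \<open>(a0, d0)\<close> encodes \<open>M0\<close>.\<close>

abbreviation d0 :: W where "d0 \<equiv> vec6 2 0 1 0 (-1) (-2)"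

lemma finite_weights [simp]: "finite weights" by (simp add: weights_def)

lemma card_weights: "card weights = 27" by (simp add: weights_def)

lemma reflection_weights: "x \<in> weights \<Longrightarrow> simple_reflection i x \<in> weights"
proof -
  have "\<forall>i. \<forall>x\<in>weights. simple_reflection i x \<in> weights"
    unfolding forall_6 by (simp add: weights_def simple_reflection_vec6)
  then show "x \<in> weights \<Longrightarrow> simple_reflection i x \<in> weights" by blast
qed

text \<open>\<open>a0\<close> is the only dominant weight; this is where the ascent by simple
  reflections stops.\<close>

lemma dominant_weights: "x \<in> weights \<Longrightarrow> x \<noteq> a0 \<Longrightarrow> \<exists>i. (cartan_E6 *v x) $ i < 0"
proof -
  have "\<forall>x\<in>weights. x = a0 \<or> (\<exists>i\<in>{1,2,3,4,5,6}. (cartan_E6 *v x) $ i < 0)"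
    by (simp add: weights_def cartan_E6_mult)
  then show "x \<in> weights \<Longrightarrow> x \<noteq> a0 \<Longrightarrow> \<exists>i. (cartan_E6 *v x) $ i < 0" by blast
qed

text \<open>The same uniqueness for the subsystem of type D5 on the nodes 1 to 5, whose reflections
  fix \<open>a0\<close>.\<close>

lemma dominant_inner_a0:
  "x \<in> weights \<Longrightarrow> inner_W a0 x = - 6 \<Longrightarrow> x \<noteq> d0 \<Longrightarrow> \<exists>i\<in>{1,2,3,4,5}. (cartan_E6 *v x) $ i < 0"
proof -
  have "\<forall>x\<in>weights. inner_W a0 x = - 6 \<longrightarrow> x = d0 \<or> (\<exists>i\<in>{1,2,3,4,5}. (cartan_E6 *v x) $ i < 0)"
    by (simp add: weights_def cartan_E6_mult inner_W_expand)
  then show "x \<in> weights \<Longrightarrow> inner_W a0 x = - 6 \<Longrightarrow> x \<noteq> d0 \<Longrightarrow> \<exists>i\<in>{1,2,3,4,5}. (cartan_E6 *v x) $ i < 0"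
    by blast
qed

lemma sum_weights_first: "(\<Sum>x\<in>weights. inner_W x w) = 0"
  by (simp add: weights_def inner_W_expand)

lemma sum_weights_sq: "(\<Sum>x\<in>weights. inner_W x w ^ 2) = 54 * inner_W w w"
  by (simp add: weights_def inner_W_expand) algebra

text \<open>The weights are not closed under negation; the sum vanishes because W(E6) has no nonzero
  cubic invariant. The proof verifies it as a polynomial identity in the coordinates of
  \<open>w\<close>.\<close>

lemma sum_weights_third: "(\<Sum>x\<in>weights. inner_W x w ^ 3) = 0"
  by (simp add: weights_def inner_W_expand) algebra

text \<open>W(E6) has no quartic invariant besides the square of the form. The factor is 27 * 12^2 *
  3 / (6 * 8), from 27 vectors of squared length 12 in dimension 6.\<close>

lemma sum_weights_fourth: "(\<Sum>x\<in>weights. inner_W x w ^ 4) = 243 * inner_W w w ^ 2"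
  by (simp add: weights_def inner_W_expand) algebra

text \<open>Squares are completed from the leaves 1, 2, 6 of the Dynkin diagram inwards to the
  branch node 4; the remainder 1/6 is positive, which gives definiteness.\<close>

lemma inner_W_sos:
  "inner_W v v = 2 * (v $ 1 - v $ 3 / 2)\<^sup>2 + 2 * (v $ 2 - v $ 4 / 2)\<^sup>2 + 2 * (v $ 6 - v $ 5 / 2)\<^sup>2
     + 3 / 2 * (v $ 3 - 2 / 3 * v $ 4)\<^sup>2 + 3 / 2 * (v $ 5 - 2 / 3 * v $ 4)\<^sup>2 + 1 / 6 * (v $ 4)\<^sup>2"
  unfolding inner_W_expand by (simp add: power2_eq_square field_simps)

global_interpretation W: inner_form inner_W
proof
  show "bilinear inner_W"
    by (auto simp: bilinear_def inner_W_def matrix_vector_right_distrib matrix_vector_mult_scaleR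
        inner_add_left inner_add_right intro!: linearI)
  show "inner_W x y = inner_W y x" for x y
    by (simp add: inner_W_expand algebra_simps)
  show "inner_W x x > 0" if "x \<noteq> 0" for x
  proof -
    have "inner_W x x = 0 \<Longrightarrow> x = 0"
      unfolding inner_W_sos by (simp add: add_nonneg_eq_0_iff vec_eq_iff forall_6)
    moreover have "inner_W x x \<ge> 0" unfolding inner_W_sos by simp
    ultimately show ?thesis using that by fastforce
  qed
qed

global_interpretation V: inner_form inner_V
proof
  show "bilinear inner_V"
    by (auto simp: bilinear_def inner_V_def algebra_simps intro!: linearI)
  show "inner_V x y = inner_V y x" for x y
    by (simp add: inner_V_def W.sym)
  show "inner_V x x > 0" if "x \<noteq> 0" for x
    using that W.pos[of "fst x"] W.pos[of "snd x"] W.nonneg[of "fst x"] W.nonneg[of "snd x"]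
    by (cases "fst x = 0") (auto simp: inner_V_def prod_eq_iff intro: add_pos_nonneg)
qed

section \<open>The Weyl group generated by the simple reflections\<close>

lemma simple_reflection_eq:
  "simple_reflection i v = v - inner_W (axis i 1) v *\<^sub>R axis i 1"
  by (simp add: simple_reflection_def inner_W_def inner_axis')

lemma inner_W_axis: "inner_W (axis i 1) (axis i 1) = 2"
  using exhaust_6[of i] by (auto simp: inner_W_expand axis_def)

lemma linear_simple_reflection: "linear (simple_reflection i)"
  by (rule linearI) (simp_all add: simple_reflection_eq algebra_simps)

lemma simple_reflection_inner: "inner_W (simple_reflection i v) (simple_reflection i w) = inner_W v w"
  using W.sym[of v "axis i 1"]
  by (simp add: simple_reflection_eq inner_W_axis algebra_simps)

lemma simple_reflection_involution [simp]: "simple_reflection i (simple_reflection i v) = v"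
  by (simp add: simple_reflection_eq inner_W_axis)

lemma simple_reflection_Bij: "simple_reflection i \<in> Bij UNIV"
  unfolding Bij_def by (auto simp: bij_betw_def intro!: injI surjI simple_reflection_involution)
   (metis simple_reflection_involution)

lemma weyl_id: "(\<lambda>x. x) \<in> weyl_E6"
  using generate.one[of "BijGroup UNIV"] by (simp add: weyl_E6_def BijGroup_def restrict_UNIV)

lemma weyl_Bij: "g \<in> weyl_E6 \<Longrightarrow> g \<in> Bij UNIV"
  using group.generate_in_carrier[OF group_BijGroup, of "range simple_reflection" UNIV g]
    simple_reflection_Bij
  by (auto simp: weyl_E6_def BijGroup_def)

lemma weyl_reflection: "simple_reflection i \<in> weyl_E6"
  unfolding weyl_E6_def by (intro generate.incl) auto

lemma BijGroup_UNIV_mult: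
  "g \<in> Bij UNIV \<Longrightarrow> h \<in> Bij UNIV \<Longrightarrow> g \<otimes>\<^bsub>BijGroup UNIV\<^esub> h = (\<lambda>x. g (h x))"
  by (auto simp: BijGroup_def compose_def)

lemma weyl_comp:
  assumes "g \<in> weyl_E6" "h \<in> weyl_E6"
  shows "(\<lambda>x. g (h x)) \<in> weyl_E6"
  using generate.eng[of g "BijGroup UNIV" "range simple_reflection" h] assms weyl_Bij
  by (simp add: weyl_E6_def BijGroup_UNIV_mult)

text \<open>There is no case for inverses because each generator is its own inverse.\<close>

lemma weyl_induct [consumes 1, case_names id reflection comp]:
  assumes g: "g \<in> weyl_E6"
    and id: "P (\<lambda>x. x)" and refl: "\<And>i. P (simple_reflection i)"
    and comp: "\<And>g h. g \<in> weyl_E6 \<Longrightarrow> h \<in> weyl_E6 \<Longrightarrow> P g \<Longrightarrow> P h \<Longrightarrow> P (\<lambda>x. g (h x))"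
  shows "P g"
  using g[unfolded weyl_E6_def]
proof (induction rule: generate.induct)
  case one
  then show ?case using id by (simp add: BijGroup_def restrict_UNIV)
next
  case (incl h)
  then show ?case using refl by auto
next
  case (inv h)
  then obtain i where h: "h = simple_reflection i" by auto
  have "inv_into UNIV h = h"
    unfolding h by (rule inv_unique_comp) auto
  then show ?case
    using refl simple_reflection_Bij by (simp add: inv_BijGroup h restrict_UNIV)
next
  case (eng g h)
  then show ?case
    using comp weyl_Bij unfolding weyl_E6_def[symmetric] by (simp add: BijGroup_UNIV_mult)
qed

lemma weyl_inverse:
  "g \<in> weyl_E6 \<Longrightarrow> \<exists>h\<in>weyl_E6. \<forall>x. g (h x) = x \<and> h (g x) = x"
proof (induction rule: weyl_induct)
  case (comp g h)
  then show ?case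
    by (elim bexE, rename_tac g' h', rule_tac x = "\<lambda>x. h' (g' x)" in bexI) (auto intro: weyl_comp)
next
  case (reflection i)
  show ?case
    by (rule bexI[of _ "simple_reflection i"]) (simp_all add: weyl_reflection)
qed (auto intro: weyl_id)

lemma weyl_linear: "g \<in> weyl_E6 \<Longrightarrow> linear g"
  by (induction rule: weyl_induct)
    (auto simp: linear_simple_reflection linear_ident intro: linear_compose[unfolded o_def])

lemma weyl_inner: "g \<in> weyl_E6 \<Longrightarrow> inner_W (g v) (g w) = inner_W v w"
  by (induction arbitrary: v w rule: weyl_induct) (simp_all add: simple_reflection_inner)

lemma weyl_weights: "g \<in> weyl_E6 \<Longrightarrow> x \<in> weights \<Longrightarrow> g x \<in> weights"
  by (induction arbitrary: x rule: weyl_induct) (simp_all add: reflection_weights)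

text \<open>
  Reflecting in a simple root on which \<open>x\<close> is negative increases the sum of the coordinates.
\<close>

lemma dominant_induct:
  assumes S: "finite S" "\<And>i x. i \<in> I \<Longrightarrow> x \<in> S \<Longrightarrow> simple_reflection i x \<in> S"
    and dominant: "\<And>x. x \<in> S \<Longrightarrow> x \<noteq> d \<Longrightarrow> \<exists>i\<in>I. (cartan_E6 *v x) $ i < 0"
    and base: "P d" and step: "\<And>i x. i \<in> I \<Longrightarrow> P x \<Longrightarrow> P (simple_reflection i x)"
    and x: "x \<in> S"
  shows "P x"
proof (rule ccontr)
  assume "\<not> P x"
  define h where "h v = (\<Sum>j\<in>UNIV. v $ j)" for v :: W
  let ?N = "{x \<in> S. \<not> P x}"
  have "finite (h ` ?N)" "h ` ?N \<noteq> {}" using S x \<open>\<not> P x\<close> by auto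
  \<comment> \<open>A counterexample of maximal coordinate sum. Its reflection has a larger sum and
    stays in \<open>S\<close>, so it satisfies \<open>P\<close>; reflecting back by
    \<open>step\<close> gives \<open>P y\<close>.\<close>
  then obtain y where y: "y \<in> ?N" "h y = Max (h ` ?N)"
    by (metis (no_types, lifting) Max_in imageE)
  then obtain i where i: "i \<in> I" "(cartan_E6 *v y) $ i < 0"
    using dominant base by blast
  have "(\<Sum>j\<in>UNIV. axis i 1 $ j) = (1 :: real)"
    by (simp add: axis_def)
  then have "h (simple_reflection i y) = h y - (cartan_E6 *v y) $ i"
    by (simp add: h_def simple_reflection_def sum_subtractf flip: sum_distrib_left)
  then have "h (simple_reflection i y) > Max (h ` ?N)"
    using i y by simp
  then have "simple_reflection i y \<notin> ?N"
    using Max_ge[OF \<open>finite (h ` ?N)\<close>] by fastforce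
  then have "P (simple_reflection i y)"
    using S(2)[of i y] i y by simp
  then show False
    using step[OF i(1)] y by fastforce
qed

section \<open>Transitivity on weights and on pairs of weights\<close>

lemma weyl_transitive_weights:
  assumes "x \<in> weights"
  obtains g where "g \<in> weyl_E6" "g a0 = x"
proof -
  from finite_weights _ _ _ _ assms have "\<exists>g\<in>weyl_E6. g a0 = x"
  proof (rule dominant_induct[where I = UNIV and d = a0])
    fix i x assume "\<exists>g\<in>weyl_E6. g a0 = x"
    then show "\<exists>g\<in>weyl_E6. g a0 = simple_reflection i x"
      using weyl_comp[OF weyl_reflection[of i]] by fastforce
  qed (auto intro: reflection_weights dominant_weights weyl_id)
  then show ?thesis using that by blast
qed

text \<open>Under the correspondence of the weights with the 27 lines on a cubic surface, these are
  the ten lines meeting a given one.\<close>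

definition neighbours :: "W \<Rightarrow> W set" where
  "neighbours x = {y \<in> weights. inner_W x y = - 6}"

lemma finite_neighbours [simp]: "finite (neighbours x)"
  by (simp add: neighbours_def)

text \<open>The ascent argument again, using only the reflections 1 to 5, which fix
  \<open>a0\<close> and hence preserve its set of neighbours.\<close>

lemma weyl_transitive_neighbours:
  assumes "y \<in> neighbours a0"
  obtains g where "g \<in> weyl_E6" "g a0 = a0" "g d0 = y"
proof -
  let ?I = "{1, 2, 3, 4, 5} :: 6 set"
  have stab: "simple_reflection i a0 = a0" if "i \<in> ?I" for i
    using that by (auto simp: simple_reflection_vec6)
  from finite_neighbours _ _ _ _ assms have "\<exists>g\<in>weyl_E6. g a0 = a0 \<and> g d0 = y"
  proof (rule dominant_induct[where I = ?I and d = d0])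
    fix i x assume i: "i \<in> ?I" and x: "x \<in> neighbours a0"
    then show "simple_reflection i x \<in> neighbours a0"
      using simple_reflection_inner[of i a0 x] stab[OF i] by (simp add: neighbours_def reflection_weights)
  next
    fix i x assume i: "i \<in> ?I" and "\<exists>g\<in>weyl_E6. g a0 = a0 \<and> g d0 = x"
    then obtain g where "g \<in> weyl_E6" "g a0 = a0" "g d0 = x" by blast
    then show "\<exists>g\<in>weyl_E6. g a0 = a0 \<and> g d0 = simple_reflection i x"
      using weyl_comp[OF weyl_reflection] stab[OF i]
      by (intro bexI[of _ "\<lambda>x. simple_reflection i (g x)"]) simp_all
  next
    fix x assume "x \<in> neighbours a0" "x \<noteq> d0"
    then show "\<exists>i\<in>?I. (cartan_E6 *v x) $ i < 0"
      unfolding neighbours_def using dominant_inner_a0 by blast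
  qed (auto intro: weyl_id)
  then show ?thesis using that by blast
qed

lemma weyl_neighbours:
  assumes g: "g \<in> weyl_E6"
  shows "neighbours (g x) = g ` neighbours x"
proof (intro equalityI subsetI)
  fix y assume y: "y \<in> neighbours (g x)"
  obtain h where h: "h \<in> weyl_E6" "\<And>x. g (h x) = x" "\<And>x. h (g x) = x"
    using weyl_inverse[OF g] by blast
  have "h y \<in> neighbours x"
    using y weyl_weights[OF h(1)] weyl_inner[OF h(1), of "g x" y] by (simp add: neighbours_def h)
  then show "y \<in> g ` neighbours x" using h(2)[of y] by (metis imageI)
qed (auto simp: neighbours_def weyl_inner[OF g] weyl_weights[OF g])

lemma weyl_inj: "g \<in> weyl_E6 \<Longrightarrow> inj g"
  by (metis injI weyl_inverse)

lemma neighbours_a0: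
  "neighbours a0 = {d0, vec6 (-1) 0 1 0 (-1) (-2), vec6 (-1) 0 (-2) 0 (-1) (-2),
     vec6 (-1) 0 (-2) (-3) (-1) (-2), vec6 (-1) (-3) (-2) (-3) (-1) (-2),
     vec6 (-1) 0 (-2) (-3) (-4) (-2), vec6 (-1) (-3) (-2) (-3) (-4) (-2),
     vec6 (-1) (-3) (-2) (-6) (-4) (-2), vec6 (-1) (-3) (-5) (-6) (-4) (-2),
     vec6 (-4) (-3) (-5) (-6) (-4) (-2)}"
proof -
  \<comment> \<open>Filters an enumerated set one element at a time, so that \<open>simp\<close> can
    evaluate every inner product.\<close>
  have "{y \<in> insert v A. P y} = (if P v then insert v {y \<in> A. P y} else {y \<in> A. P y})"
    for v :: W and A P
    by auto
  then show ?thesis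
    by (simp add: neighbours_def weights_def inner_W_expand del: insert_iff)
qed

lemma card_neighbours:
  assumes "x \<in> weights" shows "card (neighbours x) = 10"
proof -
  obtain g where g: "g \<in> weyl_E6" "g a0 = x" using weyl_transitive_weights[OF assms] .
  have "card (neighbours x) = card (neighbours a0)"
    using weyl_neighbours[OF g(1), of a0] weyl_inj[OF g(1)] g(2) by (simp add: card_image inj_on_subset)
  also have "\<dots> = 10" by (simp add: neighbours_a0)
  finally show ?thesis .
qed

text \<open>A neighbour pair completes to a triple with sum 0, a tritangent plane in terms of the 27
  lines. By equivariance it suffices to inspect the ten neighbours of \<open>a0\<close>.\<close>

lemma neighbours_third:
  assumes "x \<in> weights" "y \<in> neighbours x" shows "- x - y \<in> neighbours x"
proof -
  obtain g where g: "g \<in> weyl_E6" "g a0 = x" using weyl_transitive_weights[OF assms(1)] .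
  obtain y' where y': "y' \<in> neighbours a0" "y = g y'" using assms weyl_neighbours[OF g(1), of a0] g(2) by auto
  have "- a0 - y' \<in> neighbours a0"
    using y'(1) unfolding neighbours_a0 by (elim insertE emptyE) (simp_all add: vec6_minus vec6_diff)
  moreover have "g (- a0 - y') = - x - y"
    using weyl_linear[OF g(1)] by (simp add: linear_diff linear_neg g y')
  ultimately show ?thesis using weyl_neighbours[OF g(1), of a0] g(2) by (metis imageI)
qed

text \<open>The ten vectors \<open>2 *\<^sub>R y + x\<close> are plus and minus an orthogonal basis
  of the complement of \<open>x\<close>, each of squared length 36. Parseval gives 72 times the
  squared length of the projection of \<open>w\<close>. The proof transports to \<open>a0\<close>
  and checks this in coordinates.\<close>

lemma sum_neighbours_sq:
  assumes "x \<in> weights"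
  shows "(\<Sum>y\<in>neighbours x. inner_W (2 *\<^sub>R y + x) w ^ 2) = 72 * inner_W w w - 6 * inner_W x w ^ 2"
proof -
  obtain g where g: "g \<in> weyl_E6" "g a0 = x" using weyl_transitive_weights[OF assms] .
  obtain h where h: "h \<in> weyl_E6" "\<And>x. g (h x) = x" "\<And>x. h (g x) = x"
    using weyl_inverse[OF g(1)] by blast
  have "(\<Sum>y\<in>neighbours x. inner_W (2 *\<^sub>R y + x) w ^ 2) =
      (\<Sum>y\<in>neighbours a0. inner_W (2 *\<^sub>R g y + g a0) (g (h w)) ^ 2)"
    using weyl_neighbours[OF g(1), of a0] weyl_inj[OF g(1)]
    by (simp add: g h sum.reindex inj_on_subset)
  also have "\<dots> = (\<Sum>y\<in>neighbours a0. inner_W (2 *\<^sub>R y + a0) (h w) ^ 2)"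
    by (simp only: weyl_inner[OF g(1)]
        linear_add[OF weyl_linear[OF g(1)], symmetric] linear_cmul[OF weyl_linear[OF g(1)], symmetric])
  also have "\<dots> = 72 * inner_W (h w) (h w) - 6 * inner_W a0 (h w) ^ 2"
    by (simp add: neighbours_a0 inner_W_expand) algebra
  also have "\<dots> = 72 * inner_W w w - 6 * inner_W x w ^ 2"
    using weyl_inner[OF g(1), of a0 "h w"] by (simp add: weyl_inner[OF h(1)] g h)
  finally show ?thesis .
qed


lemma orbit_weights: "(\<lambda>g. g a0) ` weyl_E6 = weights"
proof
  have "a0 \<in> weights" by (simp add: weights_def)
  then show "(\<lambda>g. g a0) ` weyl_E6 \<subseteq> weights" by (auto intro: weyl_weights)
  show "weights \<subseteq> (\<lambda>g. g a0) ` weyl_E6"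
  proof
    fix x assume "x \<in> weights"
    then obtain g where "g \<in> weyl_E6" "g a0 = x" by (rule weyl_transitive_weights)
    then show "x \<in> (\<lambda>g. g a0) ` weyl_E6" by blast
  qed
qed

text \<open>Transitivity in two stages: move \<open>a0\<close> to the first entry, then adjust the
  second by an element fixing \<open>a0\<close>.\<close>

lemma orbit_pairs: "(\<lambda>g. (g a0, g d0)) ` weyl_E6 = Sigma weights neighbours"
proof (intro equalityI subsetI)
  have "a0 \<in> weights" by (simp add: weights_def)
  moreover have "d0 \<in> neighbours a0" by (simp add: neighbours_a0)
  ultimately show "p \<in> Sigma weights neighbours" if "p \<in> (\<lambda>g. (g a0, g d0)) ` weyl_E6" for p
    using that by (auto intro: weyl_weights simp: weyl_neighbours)
next
  fix p assume "p \<in> Sigma weights neighbours"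
  then obtain x y where p: "p = (x, y)" "x \<in> weights" "y \<in> neighbours x" by blast
  obtain g where g: "g \<in> weyl_E6" "g a0 = x" using weyl_transitive_weights[OF p(2)] .
  obtain z where z: "z \<in> neighbours a0" "y = g z" using p(3) weyl_neighbours[OF g(1), of a0] g(2) by auto
  obtain h where h: "h \<in> weyl_E6" "h a0 = a0" "h d0 = z" using weyl_transitive_neighbours[OF z(1)] .
  show "p \<in> (\<lambda>g. (g a0, g d0)) ` weyl_E6"
    by (rule image_eqI[of _ _ "\<lambda>x. g (h x)"]) (simp_all add: p g h z weyl_comp)
qed

lemma neighbours_sym: "x \<in> weights \<Longrightarrow> y \<in> neighbours x \<Longrightarrow> x \<in> neighbours y"
  by (simp add: neighbours_def W.sym)

lemma neighbours_subset: "neighbours x \<subseteq> weights"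
  by (auto simp: neighbours_def)

text \<open>The involution sending \<open>y\<close> to \<open>- x - y\<close> permutes the
  neighbours and negates \<open>2 *\<^sub>R y + x\<close>.\<close>

lemma sum_neighbours_odd:
  assumes "x \<in> weights" "odd k"
  shows "(\<Sum>y\<in>neighbours x. inner_W (2 *\<^sub>R y + x) w ^ k) = 0"
proof -
  have "(\<Sum>y\<in>neighbours x. inner_W (2 *\<^sub>R y + x) w ^ k) =
      (\<Sum>y\<in>neighbours x. inner_W (2 *\<^sub>R (- x - y) + x) w ^ k)"
    by (rule sum.reindex_bij_witness[of _ "\<lambda>y. - x - y" "\<lambda>y. - x - y"])
      (simp_all add: neighbours_third[OF assms(1)])
  also have "\<dots> = (\<Sum>y\<in>neighbours x. - (inner_W (2 *\<^sub>R y + x) w ^ k))"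
  proof (rule sum.cong)
    fix y
    have "inner_W (2 *\<^sub>R (- x - y) + x) w = - inner_W (2 *\<^sub>R y + x) w" by simp
    then show "inner_W (2 *\<^sub>R (- x - y) + x) w ^ k = - (inner_W (2 *\<^sub>R y + x) w ^ k)"
      by (simp only: power_minus_odd[OF assms(2)])
  qed simp
  also have "\<dots> = - (\<Sum>y\<in>neighbours x. inner_W (2 *\<^sub>R y + x) w ^ k)" by (rule sum_negf)
  finally show ?thesis by simp
qed

text \<open>
  With \<open>z = - x - y\<close>, the form \<open>2 y + x\<close> is \<open>y - z\<close>.  Summing over the cyclic permutations
  of \<open>(x, y, z)\<close> and using \<open>(p - q)^4 + (q - r)^4 + (r - p)^4 = 9 (p^4 + q^4 + r^4)\<close> for
  \<open>p + q + r = 0\<close> reduces to fourth powers of the \<open>x\<close> alone.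
\<close>

lemma sum_neighbours_fourth:
  "(\<Sum>x\<in>weights. \<Sum>y\<in>neighbours x. inner_W (2 *\<^sub>R y + x) w ^ 4) = 90 * (\<Sum>x\<in>weights. inner_W x w ^ 4)"
proof -
  let ?P = "Sigma weights neighbours"
  \<comment> \<open>Rotation of the triple \<open>(x, y, - x - y)\<close>, recorded by its first two
    entries; it permutes \<open>?P\<close>.\<close>
  define rho where "rho = (\<lambda>(x :: W, y). (y, - x - y))"
  define F where "F = (\<lambda>(x, y). inner_W (2 *\<^sub>R y + x) w ^ 4)"
  define G where "G = (\<lambda>(x, y :: W). inner_W x w ^ 4)"
  have rho: "(\<Sum>p\<in>?P. H (rho p)) = (\<Sum>p\<in>?P. H p)" for H :: "W \<times> W \<Rightarrow> real"
  proof (rule sum.reindex_bij_witness[of _ "\<lambda>(x, y). (- x - y, x)" rho])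
    fix p assume "p \<in> ?P"
    then obtain x y where p: "p = (x, y)" "x \<in> weights" "y \<in> neighbours x" by blast
    have "y \<in> weights" "- x - y \<in> weights" using neighbours_third p neighbours_subset by blast+
    moreover have "- x - y \<in> neighbours y"
      using neighbours_third[OF \<open>y \<in> weights\<close> neighbours_sym[OF p(2,3)]] by (simp add: minus_diff_commute)
    moreover have "x \<in> neighbours (- x - y)" by (rule neighbours_sym[OF p(2) neighbours_third[OF p(2,3)]])
    ultimately show "rho p \<in> ?P" "(case p of (x, y) \<Rightarrow> (- x - y, x)) \<in> ?P"
      by (simp_all add: rho_def p)
  qed (auto simp: rho_def)
  have "F p + F (rho p) + F (rho (rho p)) = 9 * (G p + G (rho p) + G (rho (rho p)))" for p
  proof (cases p)
    case (Pair x y)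
    have "(2 * b + a) ^ 4 + (2 * (- a - b) + b) ^ 4 + (2 * a + (- a - b)) ^ 4 =
        9 * (a ^ 4 + b ^ 4 + (- a - b) ^ 4)" for a b :: real
      by algebra
    \<comment> \<open>Instantiation follows the order of occurrence, in which \<open>b\<close>
      precedes \<open>a\<close>; thus \<open>a\<close> stands for \<open>x\<close> and
      \<open>b\<close> for \<open>y\<close>.\<close>
    from this[of "inner_W y w" "inner_W x w"] show ?thesis
      by (simp add: Pair F_def G_def rho_def)
  qed
  then have "(\<Sum>p\<in>?P. F p + F (rho p) + F (rho (rho p))) =
      9 * (\<Sum>p\<in>?P. G p + G (rho p) + G (rho (rho p)))"
    by (simp add: sum_distrib_left)
  then have "(\<Sum>p\<in>?P. F p) = 9 * (\<Sum>p\<in>?P. G p)"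
    using rho[of F] rho[of "\<lambda>p. F (rho p)"] rho[of G] rho[of "\<lambda>p. G (rho p)"]
    by (simp add: sum.distrib)
  then have "(\<Sum>x\<in>weights. \<Sum>y\<in>neighbours x. inner_W (2 *\<^sub>R y + x) w ^ 4) =
      9 * (\<Sum>x\<in>weights. \<Sum>y\<in>neighbours x. inner_W x w ^ 4)"
    by (simp add: sum.Sigma F_def G_def del: sum_constant)
  also have "\<dots> = 90 * (\<Sum>x\<in>weights. inner_W x w ^ 4)"
    by (simp add: card_neighbours sum_distrib_left)
  finally show ?thesis .
qed

text \<open>Polarisation of the vanishing cubic sum:
  \<open>(p + q)^3 + (p - q)^3 - 2 * p^3 = 6 * p * q^2\<close>.\<close>

lemma sum_mixed_third:
  "(\<Sum>x\<in>weights. inner_W x v * inner_W x w ^ 2) = 0"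
proof -
  have "6 * (\<Sum>x\<in>weights. inner_W x v * inner_W x w ^ 2) =
      (\<Sum>x\<in>weights. inner_W x (v + w) ^ 3) + (\<Sum>x\<in>weights. inner_W x (v - w) ^ 3)
      - 2 * (\<Sum>x\<in>weights. inner_W x v ^ 3)"
    unfolding sum_distrib_left sum.distrib[symmetric] sum_subtractf[symmetric]
    by (intro sum.cong refl) (simp, algebra)
  then show ?thesis unfolding sum_weights_third by simp
qed


section \<open>The orbits\<close>

lemma vec_a_eq: "vec_a = (1 / sqrt 12) *\<^sub>R a0"
  by (simp add: vec_a_def vec6_def)

lemma vec_b_eq: "vec_b = (1 / 6) *\<^sub>R (2 *\<^sub>R d0 + a0)"
  by (simp add: vec_b_def vec_eq_iff forall_6)

text \<open>The factors are those that send \<open>(a0, d0)\<close> to \<open>M0\<close>.\<close>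

definition pair_map :: "W \<times> W \<Rightarrow> V" where
  "pair_map p = ((1 / sqrt 24) *\<^sub>R fst p, (1 / (6 * sqrt 2)) *\<^sub>R (2 *\<^sub>R snd p + fst p))"

definition angle_map :: "nat \<Rightarrow> W \<Rightarrow> V" where
  "angle_map j x = ((cos (real j * pi / 4) / sqrt 12) *\<^sub>R x, (sin (real j * pi / 4) / sqrt 12) *\<^sub>R x)"

lemma orbit_M0: "orbit_V M0 = pair_map ` Sigma weights neighbours"
proof -
  have M0: "M0 = pair_map (a0, d0)"
    using real_sqrt_mult[of 2 12] by (simp add: M0_def pair_map_def vec_a_eq vec_b_eq)
  have "orbit_V M0 = (\<lambda>g. pair_map (g a0, g d0)) ` weyl_E6"
    unfolding orbit_V_def M0
    by (intro image_cong refl)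
      (simp add: pair_map_def linear_add[OF weyl_linear] linear_cmul[OF weyl_linear])
  then show ?thesis by (simp add: orbit_pairs[symmetric] image_image)
qed

lemma orbit_C: "orbit_V (C j) = angle_map j ` weights"
proof -
  have "orbit_V (C j) = (\<lambda>g. angle_map j (g a0)) ` weyl_E6"
    unfolding orbit_V_def
    by (intro image_cong refl) (simp add: C_def vec_a_eq angle_map_def linear_cmul[OF weyl_linear])
  then show ?thesis by (simp add: orbit_weights[symmetric] image_image)
qed

lemma inj_pair_map: "inj pair_map"
  by (auto simp: inj_def pair_map_def)

lemma inj_angle_map: "inj (angle_map j)"
proof (rule injI)
  fix x y assume eq: "angle_map j x = angle_map j y"
  have "cos (real j * pi / 4) \<noteq> 0 \<or> sin (real j * pi / 4) \<noteq> 0"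
    using sin_zero_abs_cos_one[of "real j * pi / 4"] by auto
  then show "x = y" using eq by (auto simp: angle_map_def)
qed

section \<open>The four directions as half of a regular octagon\<close>

lemma less_4_cases: "j < 4 \<Longrightarrow> j = 0 \<or> j = 1 \<or> j = 2 \<or> j = (3 :: nat)"
  by auto

lemma cos_sin_three_quarters: "cos (3 * pi / 4) = - sqrt 2 / 2" "sin (3 * pi / 4) = sqrt 2 / 2"
proof -
  have "3 * pi / 4 = pi - pi / 4" by simp
  then show "cos (3 * pi / 4) = - sqrt 2 / 2" "sin (3 * pi / 4) = sqrt 2 / 2"
    by (simp_all only: cos_pi_minus sin_pi_minus cos_45 sin_45)
qed

lemmas quarter_values = cos_45 sin_45 cos_sin_three_quarters

lemma lessThan_4: "{..<4 :: nat} = {0, 1, 2, 3}"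
  by auto

lemma sum_angles:
  "(\<Sum>j<4. (cos (real j * pi / 4) * p + sin (real j * pi / 4) * q) ^ k) =
    p ^ k + (sqrt 2 / 2 * p + sqrt 2 / 2 * q) ^ k + q ^ k + (- (sqrt 2 / 2) * p + sqrt 2 / 2 * q) ^ k"
  by (simp add: lessThan_4 quarter_values)

text \<open>With their antipodes the four directions form a regular octagon, so the even power sums
  of degree 2 and 4 are isotropic; 2 and, below, 3/2 are 4 times the circle averages 1/2 and 3/8 of
  \<open>cos^2\<close> and \<open>cos^4\<close>.\<close>

lemma sum_angles_sq:
  "(\<Sum>j<4. (cos (real j * pi / 4) * p + sin (real j * pi / 4) * q) ^ 2) = 2 * (p\<^sup>2 + q\<^sup>2)"
proof -
  \<comment> \<open>Treating \<open>sqrt 2 / 2\<close> as a symbol \<open>r\<close> with a quadratic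
    relation leaves a purely algebraic identity.\<close>
  have "p ^ 2 + (r * p + r * q) ^ 2 + q ^ 2 + (- r * p + r * q) ^ 2 = 2 * (p\<^sup>2 + q\<^sup>2)"
    if "2 * (r * r) = 1" for r
    using that by algebra
  from this[of "sqrt 2 / 2"] show ?thesis
    unfolding sum_angles by simp
qed

lemma sum_angles_fourth:
  "(\<Sum>j<4. (cos (real j * pi / 4) * p + sin (real j * pi / 4) * q) ^ 4) = 3 / 2 * (p\<^sup>2 + q\<^sup>2)\<^sup>2"
proof -
  have "2 * (p ^ 4 + (r * p + r * q) ^ 4 + q ^ 4 + (- r * p + r * q) ^ 4) = 3 * (p\<^sup>2 + q\<^sup>2)\<^sup>2"
    if "2 * (r * r) = 1" for r
    using that by algebra
  from this[of "sqrt 2 / 2"] show ?thesis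
    unfolding sum_angles by simp
qed

text \<open>Two Gram entries of the columns, constant on orbits. They already separate the five
  orbits: (1/2, 0) for \<open>M0\<close> and (1, 0), (1/2, 1/2), (0, 0), (1/2, -1/2) for the
  \<open>C j\<close>.\<close>

definition gram :: "V \<Rightarrow> real \<times> real" where
  "gram x = (inner_W (fst x) (fst x), inner_W (fst x) (snd x))"

lemma gram_orbit: "y \<in> orbit_V x \<Longrightarrow> gram y = gram x"
  by (auto simp: orbit_V_def gram_def weyl_inner)

lemma inner_V_orbit: "y \<in> orbit_V x \<Longrightarrow> inner_V y y = inner_V x x"
  by (auto simp: orbit_V_def inner_V_def weyl_inner)

lemma inner_a0_d0: "inner_W a0 a0 = 12" "inner_W d0 d0 = 12" "inner_W a0 d0 = - 6" "inner_W d0 a0 = - 6"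
  by (simp_all add: inner_W_expand)

lemma inner_ab: "inner_W vec_a vec_a = 1" "inner_W vec_b vec_b = 1" "inner_W vec_a vec_b = 0"
  by (simp_all add: vec_a_eq vec_b_eq inner_a0_d0)

lemma gram_M0: "gram M0 = (1 / 2, 0)"
  by (simp add: gram_def M0_def inner_ab)

lemma gram_C:
  "gram (C j) = ((cos (real j * pi / 4))\<^sup>2, cos (real j * pi / 4) * sin (real j * pi / 4))"
  by (simp add: gram_def C_def inner_ab power2_eq_square)

lemma orbits_in_sphere: "orbit_V M0 \<subseteq> unit_sphere inner_V" "orbit_V (C j) \<subseteq> unit_sphere inner_V"
proof -
  have "inner_V M0 M0 = 1" by (simp add: inner_V_def M0_def inner_ab)
  moreover have "inner_V (C j) (C j) = 1"
    by (simp add: inner_V_def C_def inner_ab flip: power2_eq_square)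
  ultimately show "orbit_V M0 \<subseteq> unit_sphere inner_V" "orbit_V (C j) \<subseteq> unit_sphere inner_V"
    by (auto simp: unit_sphere_def inner_V_orbit)
qed

lemma orbit_disjoint: "gram x \<noteq> gram y \<Longrightarrow> orbit_V x \<inter> orbit_V y = {}"
  by (metis disjoint_iff gram_orbit)

lemma M0_C_disjoint: "j < 4 \<Longrightarrow> orbit_V M0 \<inter> orbit_V (C j) = {}"
  by (rule orbit_disjoint)
    (auto dest!: less_4_cases simp: gram_M0 gram_C quarter_values power2_eq_square)

lemma C_disjoint: "disjoint_family_on (\<lambda>j. orbit_V (C j)) {..<4}"
  unfolding disjoint_family_on_def lessThan_4
  by (intro ballI impI orbit_disjoint) (auto simp: gram_C quarter_values power2_eq_square)

lemma card_orbit_M0: "card (orbit_V M0) = 270"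
  using card_SigmaI[of weights neighbours] inj_pair_map
  by (simp add: orbit_M0 card_image inj_on_subset card_neighbours card_weights)

lemma card_orbit_C: "card (orbit_V (C j)) = 27"
  using inj_angle_map[of j] by (simp add: orbit_C card_image inj_on_subset card_weights)

section \<open>Power sums over orbits as sums over weights\<close>

lemma sum_orbit_M0:
  "(\<Sum>x\<in>orbit_V M0. inner_V x (v, w) ^ k) =
    (\<Sum>x\<in>weights. \<Sum>y\<in>neighbours x.
      (1 / sqrt 24 * inner_W x v + 1 / (6 * sqrt 2) * inner_W (2 *\<^sub>R y + x) w) ^ k)"
proof -
  have "(\<Sum>x\<in>orbit_V M0. inner_V x (v, w) ^ k) = (\<Sum>p\<in>Sigma weights neighbours. inner_V (pair_map p) (v, w) ^ k)"
    unfolding orbit_M0 by (subst sum.reindex) (auto intro: inj_on_subset[OF inj_pair_map])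
  also have "\<dots> = (\<Sum>(x, y)\<in>Sigma weights neighbours.
      (1 / sqrt 24 * inner_W x v + 1 / (6 * sqrt 2) * inner_W (2 *\<^sub>R y + x) w) ^ k)"
    by (intro sum.cong refl) (simp add: pair_map_def inner_V_def case_prod_beta)
  finally show ?thesis by (simp only: sum.Sigma[OF finite_weights] finite_neighbours simp_thms ball_triv)
qed

lemma sum_orbit_C:
  "(\<Sum>x\<in>orbit_V (C j). inner_V x (v, w) ^ k) =
    (\<Sum>x\<in>weights. (cos (real j * pi / 4) * inner_W x v + sin (real j * pi / 4) * inner_W x w) ^ k)
      / sqrt 12 ^ k"
proof -
  have "(\<Sum>x\<in>orbit_V (C j). inner_V x (v, w) ^ k) = (\<Sum>x\<in>weights. inner_V (angle_map j x) (v, w) ^ k)"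
    unfolding orbit_C by (subst sum.reindex) (auto intro: inj_on_subset[OF inj_angle_map])
  also have "\<dots> = (\<Sum>x\<in>weights.
      ((cos (real j * pi / 4) * inner_W x v + sin (real j * pi / 4) * inner_W x w) / sqrt 12) ^ k)"
    by (intro sum.cong refl) (simp add: angle_map_def inner_V_def add_divide_distrib)
  finally show ?thesis by (simp add: power_divide sum_divide_distrib)
qed


section \<open>Power sums over the orbits\<close>

text \<open>For a fixed angle, pairing with \<open>(v, w)\<close> is pairing a weight with one
  combined vector, so the odd weight sums apply.\<close>

lemma sum_C_odd:
  assumes "k = 1 \<or> k = 3"
  shows "(\<Sum>x\<in>orbit_V (C j). inner_V x (v, w) ^ k) = 0"
proof -
  have "(\<Sum>x\<in>orbit_V (C j). inner_V x (v, w) ^ k) =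
      (\<Sum>x\<in>weights. inner_W x (cos (real j * pi / 4) *\<^sub>R v + sin (real j * pi / 4) *\<^sub>R w) ^ k)
        / sqrt 12 ^ k"
    by (simp add: sum_orbit_C)
  also have "\<dots> = 0" using assms sum_weights_first by (auto simp only: sum_weights_third power_one_right)
  finally show ?thesis .
qed

lemma sum_C_sq:
  "(\<Sum>j<4. \<Sum>x\<in>orbit_V (C j). inner_V x (v, w) ^ 2) = 9 * (inner_W v v + inner_W w w)"
proof -
  have "(\<Sum>j<4. \<Sum>x\<in>orbit_V (C j). inner_V x (v, w) ^ 2) =
      (\<Sum>x\<in>weights. 2 * (inner_W x v ^ 2 + inner_W x w ^ 2)) / 12"
    unfolding sum_orbit_C sum_divide_distrib[symmetric]
    by (subst sum.swap) (simp only: sum_angles_sq, simp)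
  also have "\<dots> = 9 * (inner_W v v + inner_W w w)"
    by (simp add: sum_distrib_left[symmetric] sum.distrib sum_weights_sq)
  finally show ?thesis .
qed

text \<open>Summing over the angles first leaves a squared sum of squares; its cross term produces
  the mixed sum with factor 3/2 * 2/144 = 1/48.\<close>

lemma sum_C_fourth:
  "(\<Sum>j<4. \<Sum>x\<in>orbit_V (C j). inner_V x (v, w) ^ 4) =
    81 / 32 * (inner_W v v ^ 2 + inner_W w w ^ 2) + (\<Sum>x\<in>weights. inner_W x v ^ 2 * inner_W x w ^ 2) / 48"
proof -
  have "sqrt 12 ^ 4 = (144 :: real)"
    using power_mult[of "sqrt 12" 2 2] by simp
  then have "(\<Sum>j<4. \<Sum>x\<in>orbit_V (C j). inner_V x (v, w) ^ 4) =
      (\<Sum>x\<in>weights. 3 / 2 * (inner_W x v ^ 2 + inner_W x w ^ 2) ^ 2) / 144"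
    unfolding sum_orbit_C sum_divide_distrib[symmetric]
    by (subst sum.swap) (simp only: sum_angles_fourth)
  also have "\<dots> = 3 / 288 * (\<Sum>x\<in>weights. inner_W x v ^ 4 + inner_W x w ^ 4
      + 2 * (inner_W x v ^ 2 * inner_W x w ^ 2))"
  proof -
    have "3 / 2 * (p\<^sup>2 + q\<^sup>2)\<^sup>2 / 144 = 3 / 288 * (p ^ 4 + q ^ 4 + 2 * (p\<^sup>2 * q\<^sup>2))" for p q :: real
      by (simp add: power2_eq_square power4_eq_xxxx field_simps)
    then show ?thesis by (simp only: sum_distrib_left sum_divide_distrib)
  qed
  also have "\<dots> = 3 / 288 * (243 * inner_W v v ^ 2 + 243 * inner_W w w ^ 2
      + 2 * (\<Sum>x\<in>weights. inner_W x v ^ 2 * inner_W x w ^ 2))"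
    by (simp only: sum.distrib sum_weights_fourth sum_distrib_left)
  finally show ?thesis by (simp add: field_simps)
qed

lemma sum_neighbours_one: "x \<in> weights \<Longrightarrow> (\<Sum>y\<in>neighbours x. inner_W (2 *\<^sub>R y + x) w) = 0"
  using sum_neighbours_odd[of x 1 w] by simp

lemma sum_M0_first: "(\<Sum>x\<in>orbit_V M0. inner_V x (v, w) ^ 1) = 0"
proof -
  have "(\<Sum>y\<in>neighbours x. s * p + t * inner_W (2 *\<^sub>R y + x) w) = 10 * s * p" if "x \<in> weights" for x s t p
    by (simp only: sum.distrib sum_distrib_left[symmetric] sum_neighbours_one[OF that])
      (simp add: card_neighbours[OF that])
  then have "(\<Sum>x\<in>orbit_V M0. inner_V x (v, w) ^ 1) = (\<Sum>x\<in>weights. 10 * (1 / sqrt 24) * inner_W x v)"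
    unfolding sum_orbit_M0 by (intro sum.cong refl) (simp only: power_one_right)
  also have "\<dots> = 0" by (simp only: sum_distrib_left[symmetric] sum_weights_first)
  finally show ?thesis .
qed

lemma sum_M0_sq:
  "(\<Sum>x\<in>orbit_V M0. inner_V x (v, w) ^ 2) = 45 / 2 * (inner_W v v + inner_W w w)"
proof -
  define s t :: real where "s = 1 / sqrt 24" and "t = 1 / (6 * sqrt 2)"
  have st: "s\<^sup>2 = 1 / 24" "t\<^sup>2 = 1 / 72" by (simp_all add: s_def t_def power_divide power_mult_distrib)
  \<comment> \<open>The cross term is linear in \<open>2 *\<^sub>R y + x\<close> and sums to 0 over
    the neighbours.\<close>
  have "(\<Sum>y\<in>neighbours x. (s * inner_W x v + t * inner_W (2 *\<^sub>R y + x) w) ^ 2) =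
      10 * s\<^sup>2 * inner_W x v ^ 2 + t\<^sup>2 * (72 * inner_W w w - 6 * inner_W x w ^ 2)"
    if "x \<in> weights" for x
  proof -
    have "(s * p + t * q) ^ 2 = s\<^sup>2 * p\<^sup>2 + 2 * s * t * p * q + t\<^sup>2 * q\<^sup>2" for p q
      by algebra
    then show ?thesis
      by (simp only: sum.distrib sum_distrib_left[symmetric] sum_neighbours_one[OF that] sum_neighbours_sq[OF that])
         (simp add: card_neighbours[OF that])
  qed
  then have "(\<Sum>x\<in>orbit_V M0. inner_V x (v, w) ^ 2) =
      (\<Sum>x\<in>weights. 10 / 24 * inner_W x v ^ 2 + inner_W w w - 1 / 12 * inner_W x w ^ 2)"
    unfolding sum_orbit_M0 s_def[symmetric] t_def[symmetric]
    by (intro sum.cong refl) (simp add: st)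
  also have "\<dots> = 10 / 24 * (54 * inner_W v v) + 27 * inner_W w w - 1 / 12 * (54 * inner_W w w)"
    by (simp only: sum.distrib sum_subtractf sum_distrib_left[symmetric] sum_weights_sq) (simp add: card_weights)
  finally show ?thesis by simp
qed

lemma sum_M0_third: "(\<Sum>x\<in>orbit_V M0. inner_V x (v, w) ^ 3) = 0"
proof -
  define s t :: real where "s = 1 / sqrt 24" and "t = 1 / (6 * sqrt 2)"
  \<comment> \<open>Only the terms of even degree in \<open>2 *\<^sub>R y + x\<close> survive. What
    they leave is cubic, linear or mixed cubic in the weight \<open>x\<close>, and each of these
    sums vanishes.\<close>
  have "(\<Sum>y\<in>neighbours x. (s * inner_W x v + t * inner_W (2 *\<^sub>R y + x) w) ^ 3) =
      10 * s ^ 3 * inner_W x v ^ 3 +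
      (216 * s * t\<^sup>2 * inner_W w w) * inner_W x v - 18 * s * t\<^sup>2 * (inner_W x v * inner_W x w ^ 2)"
    if "x \<in> weights" for x
  proof -
    have "(s * p + t * q) ^ 3 =
        s ^ 3 * p ^ 3 + 3 * s\<^sup>2 * t * p\<^sup>2 * q + 3 * s * t\<^sup>2 * p * q\<^sup>2 + t ^ 3 * q ^ 3" for p q
      by algebra
    moreover have odd3: "odd (3 :: nat)" by simp
    ultimately show ?thesis
      by (simp only: sum.distrib sum_distrib_left[symmetric] sum_neighbours_one[OF that]
          sum_neighbours_sq[OF that] sum_neighbours_odd[OF that odd3])
         (simp add: card_neighbours[OF that] algebra_simps)
  qed
  then have "(\<Sum>x\<in>orbit_V M0. inner_V x (v, w) ^ 3) =
      (\<Sum>x\<in>weights. 10 * s ^ 3 * inner_W x v ^ 3 +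
        (216 * s * t\<^sup>2 * inner_W w w) * inner_W x v - 18 * s * t\<^sup>2 * (inner_W x v * inner_W x w ^ 2))"
    unfolding sum_orbit_M0 s_def[symmetric] t_def[symmetric] by (intro sum.cong refl)
  also have "\<dots> = 0"
    by (simp only: sum.distrib sum_subtractf sum_distrib_left[symmetric] sum_weights_first sum_weights_third sum_mixed_third
        mult_zero_right add_0 diff_0_right)
  finally show ?thesis .
qed

lemma sum_M0_fourth:
  "(\<Sum>x\<in>orbit_V M0. inner_V x (v, w) ^ 4) =
    135 / 32 * (inner_W v v ^ 2 + inner_W w w ^ 2) + 27 / 2 * inner_W v v * inner_W w w
      - (\<Sum>x\<in>weights. inner_W x v ^ 2 * inner_W x w ^ 2) / 48"
proof -
  define s t :: real where "s = 1 / sqrt 24" and "t = 1 / (6 * sqrt 2)"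
  have st: "s\<^sup>2 = 1 / 24" "t\<^sup>2 = 1 / 72" by (simp_all add: s_def t_def power_divide power_mult_distrib)
  have "s ^ 4 = (s\<^sup>2)\<^sup>2" "t ^ 4 = (t\<^sup>2)\<^sup>2" by algebra+
  then have st4: "s ^ 4 = 1 / 576" "t ^ 4 = 1 / 5184" unfolding st by (simp_all add: power_divide)
  \<comment> \<open>The middle binomial term carries 6/(24 * 72). Applied to
    \<open>sum_neighbours_sq\<close> it gives 1/4 and the mixed term with factor -1/48, opposite to
    the one from the \<open>C j\<close>.\<close>
  have "(\<Sum>y\<in>neighbours x. (s * inner_W x v + t * inner_W (2 *\<^sub>R y + x) w) ^ 4) =
      10 / 576 * inner_W x v ^ 4 + 1 / 4 * inner_W w w * inner_W x v ^ 2
      - 1 / 48 * (inner_W x v ^ 2 * inner_W x w ^ 2)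
      + 1 / 5184 * (\<Sum>y\<in>neighbours x. inner_W (2 *\<^sub>R y + x) w ^ 4)"
    if "x \<in> weights" for x
  proof -
    have "(s * p + t * q) ^ 4 =
        s ^ 4 * p ^ 4 + 4 * s ^ 3 * t * p ^ 3 * q + 6 * s\<^sup>2 * t\<^sup>2 * p\<^sup>2 * q\<^sup>2
        + 4 * s * t ^ 3 * p * q ^ 3 + t ^ 4 * q ^ 4" for p q
      by algebra
    moreover have odd3: "odd (3 :: nat)" by simp
    ultimately show ?thesis
      by (simp only: sum.distrib sum_distrib_left[symmetric] sum_neighbours_one[OF that]
          sum_neighbours_sq[OF that] sum_neighbours_odd[OF that odd3])
         (simp add: card_neighbours[OF that] st st4 algebra_simps)
  qed
  then have "(\<Sum>x\<in>orbit_V M0. inner_V x (v, w) ^ 4) =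
      (\<Sum>x\<in>weights. 10 / 576 * inner_W x v ^ 4 + 1 / 4 * inner_W w w * inner_W x v ^ 2
      - 1 / 48 * (inner_W x v ^ 2 * inner_W x w ^ 2)
      + 1 / 5184 * (\<Sum>y\<in>neighbours x. inner_W (2 *\<^sub>R y + x) w ^ 4))"
    unfolding sum_orbit_M0 s_def[symmetric] t_def[symmetric] by (intro sum.cong refl)
  also have "\<dots> = 10 / 576 * (243 * inner_W v v ^ 2) + 1 / 4 * inner_W w w * (54 * inner_W v v)
      - 1 / 48 * (\<Sum>x\<in>weights. inner_W x v ^ 2 * inner_W x w ^ 2)
      + 1 / 5184 * (90 * (243 * inner_W w w ^ 2))"
    by (simp only: sum.distrib sum_subtractf sum_distrib_left[symmetric] sum_weights_sq sum_weights_fourth sum_neighbours_fourth)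
  finally show ?thesis by (simp add: field_simps)
qed

theorem theorem8p1:
  fixes X :: "V set"
  assumes "X = orbit_V M0 \<union> orbit_V (C 0) \<union> orbit_V (C 1) \<union> orbit_V (C 2) \<union> orbit_V (C 3)"
  shows "spherical_design inner_V 4 X
    \<and> (\<forall>j<4. orbit_V M0 \<inter> orbit_V (C j) = {})
    \<and> disjoint_family_on (\<lambda>j. orbit_V (C j)) {..<4}
    \<and> card (orbit_V M0) = 270
    \<and> (\<forall>j<4. card (orbit_V (C j)) = 27)
    \<and> card X = 378"
proof -
  have X: "X = orbit_V M0 \<union> (\<Union>j<4. orbit_V (C j))"
    unfolding assms lessThan_4 by auto
  have finite: "finite (orbit_V M0)" "finite (orbit_V (C j))" for j
    by (simp_all add: orbit_M0 orbit_C)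
  \<comment> \<open>Stated for any commutative monoid, so that it also counts \<open>X\<close> by
    summing 1 in \<open>nat\<close>.\<close>
  have sum_X: "(\<Sum>x\<in>X. f x) = (\<Sum>x\<in>orbit_V M0. f x) + (\<Sum>j<4. \<Sum>x\<in>orbit_V (C j). f x)"
    for f :: "V \<Rightarrow> 'b::comm_monoid_add"
  proof -
    have "(\<Sum>x\<in>X. f x) = (\<Sum>x\<in>orbit_V M0. f x) + (\<Sum>x\<in>(\<Union>j<4. orbit_V (C j)). f x)"
      unfolding X using M0_C_disjoint finite by (intro sum.union_disjoint) auto
    also have "(\<Sum>x\<in>(\<Union>j<4. orbit_V (C j)). f x) = (\<Sum>j<4. \<Sum>x\<in>orbit_V (C j). f x)"
      using C_disjoint finite by (intro sum.UNION_disjoint) (auto simp: disjoint_family_on_def)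
    finally show ?thesis .
  qed
  have card_X: "card X = 378"
    using sum_X[of "\<lambda>_. 1 :: nat"] by (simp add: card_orbit_M0 card_orbit_C)
  have "\<exists>c. \<forall>y. (\<Sum>x\<in>X. inner_V x y ^ k) = c * sqrt (inner_V y y) ^ k" if "k \<le> 4" for k
  proof -
    have "k = 0 \<or> k = 1 \<or> k = 2 \<or> k = 3 \<or> k = 4" using that by auto
    then consider "k = 0" | "k = 1 \<or> k = 3" | "k = 2" | "k = 4" by blast
    then show ?thesis
    proof cases
      case 1
      then show ?thesis by simp
    next
      case 2
      then have "(\<Sum>x\<in>X. inner_V x y ^ k) = 0" for y
        using sum_M0_first sum_M0_third by (cases y) (auto simp only: sum_X sum_C_odd, simp_all)
      then show ?thesis by (intro exI[of _ 0]) simp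
    next
      case 3
      \<comment> \<open>63/2 is 45/2 + 9, in agreement with 378/12 for unit vectors in dimension
        12.\<close>
      have "(\<Sum>x\<in>X. inner_V x y ^ 2) = 63 / 2 * sqrt (inner_V y y) ^ 2" for y
      proof -
        have "sqrt (inner_V y y) ^ 2 = inner_V y y" by simp
        then show ?thesis
          by (cases y) (simp only: sum_X sum_M0_sq sum_C_sq, simp add: inner_V_def)
      qed
      then show ?thesis using 3 by blast
    next
      case 4
      \<comment> \<open>The mixed sums cancel and 135/32 + 81/32 = 27/4. The remaining product term
        has factor 27/2, twice 27/4, which completes the square of
        \<open>inner_V y y\<close>.\<close>
      have "(\<Sum>x\<in>X. inner_V x y ^ 4) = 27 / 4 * sqrt (inner_V y y) ^ 4" for y
      proof -
        have "sqrt (inner_V y y) ^ 4 = inner_V y y ^ 2"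
          using power_mult[of "sqrt (inner_V y y)" 2 2] by simp
        then show ?thesis
          by (cases y)
            (simp only: sum_X sum_M0_fourth sum_C_fourth,
              simp add: inner_V_def power2_eq_square field_simps)
      qed
      then show ?thesis using 4 by blast
    qed
  qed
  moreover have "X \<subseteq> unit_sphere inner_V"
    unfolding X using orbits_in_sphere by (intro Un_least UN_least)
  moreover have "finite X" "X \<noteq> {}"
    using card_X by (auto intro: card_ge_0_finite)
  ultimately have "spherical_design inner_V 4 X"
    by (intro V.spherical_design_if_power_sums)
  then show ?thesis
    using M0_C_disjoint C_disjoint card_X by (simp add: card_orbit_M0 card_orbit_C)
qed

end
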